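(* Let $\rho\in\mathcal P(\mathbb R^d)\cap L^p(\mathbb R^d)$ for some $p>1$, and let $p'$ be the conjugate exponent of $p$. If $P\in\Pi(\rho)$ is optimal for the transportation cost $C(\rho)$, then $P(D_\alpha)=0$ whenever $\alpha>0$ satisfies $$\alpha<\phi^{-1}\left(\frac{N^2(N-1)}{2}\,\phi\left(\left(\frac{1}{\omega_d\big(N(N-1)^2\big)^{p'}\|\rho\|_p^{p'}}\right)^{1/d}\right)\right),$$ where $\omega_d$ denotes the Lebesgue measure of the ball of radius $1$ in $\mathbb R^d$. It follows that $$C(\rho)\le\frac{N^3(N-1)^2}{4}\,\phi\left(\left(\frac{1}{\omega_d\big(N(N-1)^2\big)^{p'}\|\rho\|_p^{p'}}\right)^{1/d}\right).$$
   Context: $d\ge1$ and $N>1$ are integers; $\mathcal P(X)$ is the set of Borel probability measures on $X$. $\rho\in\mathcal P(\mathbb R^d)\cap L^p(\mathbb R^d)$ means that $\rho$ is absolutely continuous with respect to Lebesgue measure with density (also denoted $\rho$) in $L^p(\mathbb R^d)$. The function $\phi:(0,+\infty)\to[0,+\infty)$ is continuous, strictly decreasing, and $\lim_{t\to0^+}\phi(t)=+\infty$; by convention $\phi(0)=+\infty$. The cost is $c(x_1,\dots,x_N)=\sum_{1\le i<j\le N}\phi(|x_i-x_j|)$ for $x_1,\dots,x_N\in\mathbb R^d$. $\Pi(\rho)$ is the set of $P\in\mathcal P(\mathbb R^{Nd})$ all of whose $N$ marginals on the factors $\mathbb R^d$ are equal to $\rho$. Set $C(\rho)=\min_{P\in\Pi(\rho)}\int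 c\,dP$; $P$ is optimal if it attains this minimum. $D_\alpha=\{(x_1,\dots,x_N)\in\mathbb R^{Nd}: |x_i-x_j|<\alpha\text{ for some }i\ne j\}$. *)

theory Defs
  imports "HOL-Probability.Probability"
begin

text \<open>\<open>\<real>\<^sup>d\<close> is a Euclidean space \<open>'a\<close> with \<open>d = DIM('a)\<close>, and \<open>\<real>\<^sup>N\<^sup>d\<close>
  is the \<open>N\<close>-fold product of \<open>'a\<close>, whose points are functions on \<open>{1..N}\<close>.\<close>

abbreviation config_space :: "nat \<Rightarrow> (nat \<Rightarrow> 'a::euclidean_space) measure" where
  "config_space N \<equiv> PiM {1..N} (\<lambda>_. borel)"

text \<open>The exponent ranges over \<open>(1,\<infinity>]\<close>, with \<open>p = \<infinity>\<close> read as essential boundedness.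
  The value of \<open>Lp_norm\<close> is meaningful only for functions satisfying \<open>in_Lp\<close>.\<close>

definition in_Lp :: "ennreal \<Rightarrow> ('a::euclidean_space \<Rightarrow> real) \<Rightarrow> bool" where
  "in_Lp p f \<longleftrightarrow> f \<in> borel_measurable borel \<and>
     (if p = \<infinity> then esssup lborel (\<lambda>x. ennreal \<bar>f x\<bar>) < \<infinity>
      else integrable lborel (\<lambda>x. \<bar>f x\<bar> powr enn2real p))"

definition Lp_norm :: "ennreal \<Rightarrow> ('a::euclidean_space \<Rightarrow> real) \<Rightarrow> real" where
  "Lp_norm p f =
     (if p = \<infinity> then enn2real (esssup lborel (\<lambda>x. ennreal \<bar>f x\<bar>))
      else (LINT x|lborel. \<bar>f x\<bar> powr enn2real p) powr (1 / enn2real p))"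

text \<open>\<open>\<rho>\<close> is a Borel probability measure with Lebesgue density \<open>f\<close> in \<open>L\<^sup>p\<close>.\<close>

definition prob_with_Lp_density ::
    "ennreal \<Rightarrow> 'a::euclidean_space measure \<Rightarrow> ('a \<Rightarrow> real) \<Rightarrow> bool" where
  "prob_with_Lp_density p \<rho> f \<longleftrightarrow>
     \<rho> \<in> space (prob_algebra borel) \<and> in_Lp p f \<and> (AE x in lborel. 0 \<le> f x) \<and>
     \<rho> = density lborel (\<lambda>x. ennreal (f x))"

text \<open>A potential on \<open>(0,\<infinity>)\<close> is a function on the reals whose values outside \<open>(0,\<infinity>)\<close>
  are never used; \<open>ext_potential\<close> implements the convention \<open>\<phi>(0) = \<infinity>\<close>.\<close>

definition admissible_potential :: "(real \<Rightarrow> real) \<Rightarrow> bool" where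
  "admissible_potential \<phi> \<longleftrightarrow>
     continuous_on {0<..} \<phi> \<and> (\<forall>t>0. 0 \<le> \<phi> t) \<and>
     strict_antimono_on {0<..} \<phi> \<and> filterlim \<phi> at_top (at_right 0)"

definition ext_potential :: "(real \<Rightarrow> real) \<Rightarrow> real \<Rightarrow> ennreal" where
  "ext_potential \<phi> t = (if t = 0 then \<infinity> else ennreal (\<phi> t))"

definition cost :: "(real \<Rightarrow> real) \<Rightarrow> nat \<Rightarrow> (nat \<Rightarrow> 'a::euclidean_space) \<Rightarrow> ennreal" where
  "cost \<phi> N x = (\<Sum>i\<in>{1..N}. \<Sum>j\<in>{i<..N}. ext_potential \<phi> (norm (x i - x j)))"

definition transport_plans ::
    "nat \<Rightarrow> 'a::euclidean_space measure \<Rightarrow> (nat \<Rightarrow> 'a) measure set" where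
  "transport_plans N \<rho> =
     {P \<in> space (prob_algebra (config_space N)). \<forall>i\<in>{1..N}. distr P borel (\<lambda>x. x i) = \<rho>}"

text \<open>The minimal cost is taken as the infimum, so that it is defined without presupposing
  the existence of an optimal plan.\<close>

definition min_cost :: "(real \<Rightarrow> real) \<Rightarrow> nat \<Rightarrow> 'a::euclidean_space measure \<Rightarrow> ennreal" where
  "min_cost \<phi> N \<rho> = (INF P\<in>transport_plans N \<rho>. \<integral>\<^sup>+ x. cost \<phi> N x \<partial>P)"

definition optimal_plan ::
    "(real \<Rightarrow> real) \<Rightarrow> nat \<Rightarrow> 'a::euclidean_space measure \<Rightarrow> (nat \<Rightarrow> 'a) measure \<Rightarrow> bool" where
  "optimal_plan \<phi> N \<rho> P \<longleftrightarrow>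
     P \<in> transport_plans N \<rho> \<and> (\<integral>\<^sup>+ x. cost \<phi> N x \<partial>P) = min_cost \<phi> N \<rho>"

definition near_diagonal :: "nat \<Rightarrow> real \<Rightarrow> (nat \<Rightarrow> 'a::euclidean_space) set" where
  "near_diagonal N \<alpha> = {x \<in> space (config_space N).
     \<exists>i\<in>{1..N}. \<exists>j\<in>{1..N}. i \<noteq> j \<and> norm (x i - x j) < \<alpha>}"

definition critical_radius ::
    "nat \<Rightarrow> ennreal \<Rightarrow> real \<Rightarrow> ('a::euclidean_space \<Rightarrow> real) \<Rightarrow> real" where
  "critical_radius N p p' f =
     (1 / (measure lborel (ball (0::'a) 1) * (real N * (real N - 1)\<^sup>2) powr p' *
           Lp_norm p f powr p')) powr (1 / real DIM('a))"

end

theory Submission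
  imports Defs
begin

text \<open>By Hoelder's inequality, balls smaller than the critical radius have small mass. Hence two
  independent configurations drawn from a plan are, with probability at least some \<open>\<delta> > 0\<close>, such
  that exchanging their \<open>i\<close>-th particles creates no new close pairs: the exchange costs at most
  \<open>K = 2 (N - 1) \<phi> r\<close>, but it saves \<open>\<phi> |x\<^sub>i - x\<^sub>j|\<close>. Exchanging only when \<open>i\<close> and \<open>j\<close> are too close
  yields a new plan, so that \<open>2 C(\<rho>) + \<delta> \<integral> (\<phi> |x\<^sub>i - x\<^sub>j| - K)\<^sup>+ dP \<le> 2 \<integral> c dP\<close> for every plan \<open>P\<close>. An
  optimal plan of finite cost therefore does not charge close pairs, and plans whose cost tends to
  \<open>C(\<rho>)\<close> give the bound on \<open>C(\<rho>)\<close>, without any appeal to the existence of an optimal plan.\<close>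

subsection \<open>The cost of an exchange of particles\<close>

lemma ext_potential_antimono:
  assumes "admissible_potential \<phi>" "0 < s" "s \<le> t"
  shows "ext_potential \<phi> t \<le> ennreal (\<phi> s)"
proof (cases "s = t")
  case False
  then have "\<phi> t < \<phi> s"
    using assms by (auto simp: admissible_potential_def monotone_on_def)
  with assms show ?thesis by (auto simp: ext_potential_def intro!: ennreal_leI)
qed (use assms in \<open>auto simp: ext_potential_def\<close>)

lemma ext_potential_ge:
  assumes "admissible_potential \<phi>" "0 \<le> t" "t \<le> s" "0 < s"
  shows "ennreal (\<phi> s) \<le> ext_potential \<phi> t"
  using ext_potential_antimono[OF assms(1), of t s] assms
  by (cases "t = 0") (auto simp: ext_potential_def)

lemma ext_potential_norm_measurable:
  assumes "admissible_potential \<phi>" and [measurable]: "g \<in> borel_measurable M"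
  shows "(\<lambda>x. ext_potential \<phi> (norm (g x :: 'a::euclidean_space))) \<in> borel_measurable M"
proof -
  \<comment> \<open>Outside the open half-line the values of \<open>\<phi>\<close> are arbitrary,
    possibly not even Borel. The cut-off function is Borel by continuity and agrees with
    \<open>\<phi>\<close> at every positive norm.\<close>
  have [measurable]: "(\<lambda>t. indicator {0<..} t *\<^sub>R \<phi> t) \<in> borel_measurable borel"
    using assms(1) by (intro borel_measurable_continuous_on_indicator)
      (auto simp: admissible_potential_def)
  have "(\<lambda>x. ext_potential \<phi> (norm (g x))) =
      (\<lambda>x. if norm (g x) = 0 then \<infinity> else ennreal (indicator {0<..} (norm (g x)) *\<^sub>R \<phi> (norm (g x))))"
    by (auto simp: ext_potential_def)
  then show ?thesis by simp
qed

lemma cost_measurable: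
  assumes "admissible_potential \<phi>"
  shows "cost \<phi> N \<in> borel_measurable (config_space N :: (nat \<Rightarrow> 'a::euclidean_space) measure)"
proof -
  have "(\<lambda>x. ext_potential \<phi> (norm (x i - x j))) \<in>
      borel_measurable (config_space N :: (nat \<Rightarrow> 'a) measure)"
    if "i \<in> {1..N}" "j \<in> {i<..N}" for i j
  proof -
    have ij: "i \<in> {1..N}" "j \<in> {1..N}" using that by auto
    show ?thesis
      by (intro ext_potential_norm_measurable[OF assms] borel_measurable_diff
          measurable_component_singleton ij)
  qed
  then show ?thesis unfolding cost_def[abs_def] by (intro borel_measurable_sum)
qed

text \<open>Only the pairs that contain \<open>i\<close> feel the new position \<open>v\<close>. The
  first sum is thus the same before and after an exchange and will cancel.\<close>

lemma cost_fun_upd: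
  assumes "i \<in> {1..N}"
  shows "cost \<phi> N (x(i := v)) =
    (\<Sum>(a, b)\<in>{(a, b). a \<in> {1..N} \<and> b \<in> {a<..N} \<and> a \<noteq> i \<and> b \<noteq> i}. ext_potential \<phi> (norm (x a - x b))) +
    (\<Sum>k\<in>{1..N} - {i}. ext_potential \<phi> (norm (v - x k)))"
proof -
  let ?x = "x(i := v)"
  let ?e = "\<lambda>(a, b). ext_potential \<phi> (norm (?x a - ?x b))"
  let ?S = "SIGMA a:{1..N}. {a<..N}"
  have fin: "finite ?S" by simp
  have "cost \<phi> N ?x = sum ?e ?S"
    unfolding cost_def by (subst sum.Sigma) auto
  also have "\<dots> = sum ?e {z\<in>?S. fst z \<noteq> i \<and> snd z \<noteq> i} + sum ?e {z\<in>?S. \<not> (fst z \<noteq> i \<and> snd z \<noteq> i)}"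
    by (subst sum.union_disjoint[symmetric]) (auto intro!: sum.cong finite_subset[OF _ fin])
  also have "sum ?e {z\<in>?S. fst z \<noteq> i \<and> snd z \<noteq> i} =
      (\<Sum>(a, b)\<in>{(a, b). a \<in> {1..N} \<and> b \<in> {a<..N} \<and> a \<noteq> i \<and> b \<noteq> i}. ext_potential \<phi> (norm (x a - x b)))"
    by (intro sum.cong) auto
  also have "sum ?e {z\<in>?S. \<not> (fst z \<noteq> i \<and> snd z \<noteq> i)} =
      (\<Sum>k\<in>{1..N} - {i}. ext_potential \<phi> (norm (v - x k)))"
    \<comment> \<open>A pair that contains \<open>i\<close> is determined by its other entry
      \<open>k\<close>; in increasing order it is \<open>(min i k, max i k)\<close>.\<close>
    by (rule sum.reindex_bij_witness[where j = "\<lambda>(a, b). if a = i then b else a"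
          and i = "\<lambda>k. (min i k, max i k)"])
      (use assms in \<open>auto simp: norm_minus_commute min_def max_def split: if_splits\<close>)
  finally show ?thesis .
qed

text \<open>The pairs avoiding \<open>i\<close> cancel. After the exchange the
  \<open>2 (N - 1)\<close> pairs containing \<open>i\<close> have distance at least \<open>r\<close>
  and together cost at most \<open>K\<close>; before it, the pairs of \<open>i\<close> and
  \<open>j\<close> in the two configurations already cost \<open>?e + ?f\<close>.\<close>

lemma cost_swap_le:
  assumes \<phi>: "admissible_potential \<phi>"
    and ij: "i \<in> {1..N}" "j \<in> {1..N}" "i \<noteq> j"
    and r: "0 < r" "2 * (real N - 1) * \<phi> r \<le> K"
    and far: "\<And>k. k \<in> {1..N} - {i} \<Longrightarrow> r \<le> norm (y i - x k) \<and> r \<le> norm (x i - y k)"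
    and large: "ennreal K \<le> ext_potential \<phi> (norm (x i - x j)) \<or>
                ennreal K \<le> ext_potential \<phi> (norm (y i - y j))"
  shows "cost \<phi> N (x(i := y i)) + cost \<phi> N (y(i := x i)) +
           (ext_potential \<phi> (norm (x i - x j)) - ennreal K) \<le> cost \<phi> N x + cost \<phi> N y"
proof -
  define A where "A = (\<lambda>x::nat \<Rightarrow> 'a. \<Sum>(a, b)\<in>{(a, b). a \<in> {1..N} \<and> b \<in> {a<..N} \<and> a \<noteq> i \<and> b \<noteq> i}.
    ext_potential \<phi> (norm (x a - x b)))"
  define B where "B = (\<lambda>v (x::nat \<Rightarrow> 'a). \<Sum>k\<in>{1..N} - {i}. ext_potential \<phi> (norm (v - x k)))"
  have c: "cost \<phi> N (x(i := v)) = A x + B v x" for x v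
    unfolding A_def B_def by (rule cost_fun_upd[OF ij(1)])
  have c': "cost \<phi> N x = A x + B (x i) x" for x
    using c[of x "x i"] by simp
  have \<phi>r: "0 \<le> \<phi> r" using \<phi> r by (auto simp: admissible_potential_def)
  have N: "N \<ge> 1" using ij by auto
  have Bfar: "B v x \<le> ennreal ((real N - 1) * \<phi> r)"
    if "\<And>k. k \<in> {1..N} - {i} \<Longrightarrow> r \<le> norm (v - x k)" for v x
  proof -
    have "B v x \<le> of_nat (card ({1..N} - {i})) * ennreal (\<phi> r)"
      unfolding B_def using that ext_potential_antimono[OF \<phi> r(1)]
      by (intro sum_bounded_above) auto
    also have "\<dots> = ennreal ((real N - 1) * \<phi> r)"
      using ij N \<phi>r by (simp add: ennreal_mult'' of_nat_diff flip: ennreal_of_nat_eq_real_of_nat)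
         (simp add: ennreal_of_nat_eq_real_of_nat of_nat_diff)
    finally show ?thesis .
  qed
  have near: "ext_potential \<phi> (norm (x i - x j)) \<le> B (x i) x" for x
    unfolding B_def using ij by (intro member_le_sum) auto
  let ?e = "ext_potential \<phi> (norm (x i - x j))" and ?f = "ext_potential \<phi> (norm (y i - y j))"
  have "B (y i) x + B (x i) y \<le> ennreal ((real N - 1) * \<phi> r) + ennreal ((real N - 1) * \<phi> r)"
    using far by (intro add_mono Bfar) auto
  also have "\<dots> = ennreal (2 * (real N - 1) * \<phi> r)"
    using N \<phi>r by (simp flip: ennreal_plus)
  also have "\<dots> \<le> ennreal K" by (rule ennreal_leI[OF r(2)])
  finally have "B (y i) x + B (x i) y + (?e - ennreal K) \<le> ennreal K + (?e - ennreal K)"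
    by (rule add_right_mono)
  also have "\<dots> \<le> ?e + ?f"
  \<comment> \<open>Subtraction in \<open>ennreal\<close> truncates at 0. If \<open>K\<close> is at
    most \<open>?e\<close>, the left side is just \<open>?e\<close>; otherwise the difference is 0
    and \<open>large\<close> bounds \<open>K\<close> by \<open>?f\<close>.\<close>
  proof (cases "ennreal K \<le> ?e")
    case True
    then show ?thesis by (simp add: add_diff_inverse_ennreal)
  next
    case False
    then have "?e - ennreal K = 0" "ennreal K \<le> ?f" 
      using large by (auto simp: diff_eq_0_iff_ennreal less_top[symmetric] intro: ennreal_minus_eq_0)
    then show ?thesis by (simp add: add_increasing)
  qed
  also have "\<dots> \<le> B (x i) x + B (y i) y" by (intro add_mono near)
  finally have "(A x + A y) + (B (y i) x + B (x i) y + (?e - ennreal K)) \<le> (A x + A y) + (B (x i) x + B (y i) y)"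
    by (rule add_left_mono)
  then show ?thesis
    unfolding c c'[of x] c'[of y] by (simp add: ac_simps)
qed

subsection \<open>Exchanging particles between independent configurations\<close>

lemma transport_plansD:
  assumes "P \<in> transport_plans N \<rho>"
  shows "prob_space P" "sets P = sets (config_space N)"
    "\<And>i. i \<in> {1..N} \<Longrightarrow> distr P borel (\<lambda>x. x i) = \<rho>"
  using assms by (auto simp: transport_plans_def space_prob_algebra)

text \<open>A union bound: the complement is covered by \<open>2 (N - 1)\<close> events, in each of
  which one coordinate of \<open>y\<close> lies in a ball of radius \<open>r\<close> about a
  coordinate of \<open>x\<close>. Every coordinate has law \<open>\<rho>\<close>, so the estimate is
  uniform in \<open>x\<close>, however the particles depend on each other under
  \<open>P\<close>.\<close>

lemma emeasure_far_ge:
  fixes \<rho> :: "'a::euclidean_space measure"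
  assumes P: "P \<in> transport_plans N \<rho>" and i: "i \<in> {1..N}"
    and c: "\<And>x. emeasure \<rho> (ball x r) \<le> ennreal c" "0 \<le> c"
  shows "ennreal (1 - 2 * (real N - 1) * c) \<le>
    emeasure P {y\<in>space (config_space N). \<forall>k\<in>{1..N} - {i}. r \<le> norm (y i - x k) \<and> r \<le> norm (x i - y k)}"
proof -
  interpret P: prob_space P by (rule transport_plansD[OF P])
  have sets_P [measurable_cong, simp]: "sets P = sets (config_space N)" by (rule transport_plansD[OF P])
  have space_P: "space P = space (config_space N)" using sets_P by (rule sets_eq_imp_space_eq)
  have comp: "(\<lambda>y. y k) \<in> measurable P borel" if "k \<in> {1..N}" for k
    using that by (simp add: measurable_cong_sets[OF sets_P refl])
  define E where "E = (\<lambda>k a. {y\<in>space P. y k \<in> ball a r})"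
  have E_sets: "E k a \<in> sets P" if "k \<in> {1..N}" for k a
    unfolding E_def using comp[OF that] by (rule measurable_sets_Collect[unfolded]) auto
  have E_le: "P.prob (E k a) \<le> c" if "k \<in> {1..N}" for k a
  proof -
    have "emeasure P (E k a) = emeasure (distr P borel (\<lambda>y. y k)) (ball a r)"
      using comp[OF that] by (subst emeasure_distr) (auto simp: E_def intro!: arg_cong2[where f = emeasure])
    also have "\<dots> \<le> ennreal c" using c transport_plansD(3)[OF P that] by simp
    finally show ?thesis using c by (simp add: P.emeasure_eq_measure)
  qed
  define J where "J = {1..N} - {i}"
  have J: "finite J" "real (card J) = real N - 1" using i by (auto simp: J_def of_nat_diff)
  define B where "B = (\<Union>k\<in>J. E i (x k) \<union> E k (x i))"
  have B_sets: "B \<in> sets P"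
    unfolding B_def using i by (intro sets.finite_UN sets.Un E_sets J) (auto simp: J_def)
  have "P.prob B \<le> (\<Sum>k\<in>J. P.prob (E i (x k) \<union> E k (x i)))"
    unfolding B_def using i J E_sets by (intro P.finite_measure_subadditive_finite) (auto simp: J_def)
  also have "\<dots> \<le> (\<Sum>k\<in>J. c + c)"
  proof (intro sum_mono)
    fix k assume "k \<in> J"
    then have k: "k \<in> {1..N}" by (simp add: J_def)
    have "P.prob (E i (x k) \<union> E k (x i)) \<le> P.prob (E i (x k)) + P.prob (E k (x i))"
      by (intro measure_Un_le E_sets i k)
    also have "\<dots> \<le> c + c" by (intro add_mono E_le i k)
    finally show "P.prob (E i (x k) \<union> E k (x i)) \<le> c + c" .
  qed
  also have "\<dots> = 2 * (real N - 1) * c" by (simp add: J(2) algebra_simps)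
  finally have "1 - 2 * (real N - 1) * c \<le> P.prob (space P - B)"
    using P.prob_compl[OF B_sets] by simp
  moreover have "space P - B =
    {y\<in>space (config_space N). \<forall>k\<in>{1..N} - {i}. r \<le> norm (y i - x k) \<and> r \<le> norm (x i - y k)}"
    by (auto simp: B_def E_def J_def space_P dist_norm norm_minus_commute not_less)
      (metis DiffI One_nat_def atLeastAtMost_iff leD singletonD)+
  ultimately show ?thesis by (simp add: P.emeasure_eq_measure ennreal_leI)
qed

text \<open>Swapping the two factors preserves the product measure. Integrands can therefore be
  compared after adding both orders of the pair, even where no comparison holds for a single
  order.\<close>

lemma (in prob_space) nn_integral_pair_symmetrize:
  assumes F [measurable]: "F \<in> borel_measurable (M \<Otimes>\<^sub>M M)"
  shows "2 * (\<integral>\<^sup>+z. F z \<partial>(M \<Otimes>\<^sub>M M)) = (\<integral>\<^sup>+(x, y). F (x, y) + F (y, x) \<partial>(M \<Otimes>\<^sub>M M))"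
proof -
  interpret pair_sigma_finite M M ..
  have "(\<integral>\<^sup>+z. F z \<partial>(M \<Otimes>\<^sub>M M)) = (\<integral>\<^sup>+(x, y). F (y, x) \<partial>(M \<Otimes>\<^sub>M M))"
    by (subst distr_pair_swap) (simp add: nn_integral_distr case_prod_beta')
  moreover have "(\<integral>\<^sup>+(x, y). F (x, y) + F (y, x) \<partial>(M \<Otimes>\<^sub>M M)) =
      (\<integral>\<^sup>+z. F z \<partial>(M \<Otimes>\<^sub>M M)) + (\<integral>\<^sup>+(x, y). F (y, x) \<partial>(M \<Otimes>\<^sub>M M))"
    by (simp add: nn_integral_add case_prod_beta')
  ultimately show ?thesis by (simp add: mult_2)
qed

lemma (in prob_space) nn_integral_pair_fst:
  assumes [measurable]: "h \<in> borel_measurable M"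
  shows "(\<integral>\<^sup>+z. h (fst z) \<partial>(M \<Otimes>\<^sub>M M)) = (\<integral>\<^sup>+x. h x \<partial>M)"
  by (subst nn_integral_fst[symmetric]) (simp_all add: emeasure_space_1)

text \<open>Two independent configurations drawn from \<open>P\<close> exchange their \<open>i\<close>-th particles if this creates
  no close pairs and \<open>i\<close>, \<open>j\<close> are too close in at least one of them. This condition is symmetric
  in the two configurations, which is why the marginals are kept.\<close>

lemma min_cost_exchange:
  fixes \<rho> :: "'a::euclidean_space measure"
  assumes \<phi>: "admissible_potential \<phi>"
    and P: "P \<in> transport_plans N \<rho>"
    and ij: "i \<in> {1..N}" "j \<in> {1..N}" "i \<noteq> j"
    and r: "0 < r" "2 * (real N - 1) * \<phi> r \<le> K"
    and \<delta>: "\<And>x. \<delta> \<le> emeasure P {y\<in>space (config_space N).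
      \<forall>k\<in>{1..N} - {i}. r \<le> norm (y i - x k) \<and> r \<le> norm (x i - y k)}"
  shows "2 * min_cost \<phi> N \<rho> +
      \<delta> * (\<integral>\<^sup>+x. ext_potential \<phi> (norm (x i - x j)) - ennreal K \<partial>P) \<le>
    2 * (\<integral>\<^sup>+x. cost \<phi> N x \<partial>P)"
proof -
  note One_nat_def [simp del]
  let ?C = "config_space N :: (nat \<Rightarrow> 'a) measure"
  interpret P: prob_space P by (rule transport_plansD[OF P])
  have sets_P [measurable_cong, simp]: "sets P = sets ?C" by (rule transport_plansD[OF P])
  have space_P: "space P = space ?C" using sets_P by (rule sets_eq_imp_space_eq)
  interpret PP: pair_prob_space P P ..
  let ?PP = "P \<Otimes>\<^sub>M P"
  define e where "e = (\<lambda>x::nat \<Rightarrow> 'a. ext_potential \<phi> (norm (x i - x j)))"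
  define far where "far = (\<lambda>(x :: nat \<Rightarrow> 'a, y :: nat \<Rightarrow> 'a).
    \<forall>k\<in>{1..N} - {i}. r \<le> norm (y i - x k) \<and> r \<le> norm (x i - y k))"
  define G where "G = (\<lambda>(x, y). far (x, y) \<and> (ennreal K \<le> e x \<or> ennreal K \<le> e y))"
  \<comment> \<open>\<open>T\<close> returns only the first configuration after the exchange. As
    \<open>G\<close> is symmetric, \<open>T (y, x)\<close> is the second one.\<close>
  define T where "T = (\<lambda>(x, y). if G (x, y) then x(i := y i) else x)"
  have far_sym: "far (x, y) \<longleftrightarrow> far (y, x)" for x y
    by (auto simp: far_def norm_minus_commute)
  have G_sym: "G (x, y) \<longleftrightarrow> G (y, x)" for x y
    using far_sym[of x y] by (auto simp: G_def)
  have comp: "(\<lambda>x. x k) \<in> measurable ?C borel" if "k \<in> {1..N}" for k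
    using that by simp
  have comp1: "(\<lambda>z. fst z k) \<in> measurable ?PP borel" if "k \<in> {1..N}" for k
    by (rule measurable_compose[OF _ comp[OF that]]) measurable
  have comp2: "(\<lambda>z. snd z k) \<in> measurable ?PP borel" if "k \<in> {1..N}" for k
    by (rule measurable_compose[OF _ comp[OF that]]) measurable
  have [measurable]: "e \<in> borel_measurable ?C"
    unfolding e_def by (intro ext_potential_norm_measurable \<phi> borel_measurable_diff comp ij)
  have [measurable]: "cost \<phi> N \<in> borel_measurable ?C" by (rule cost_measurable[OF \<phi>])
  have far_meas [measurable]: "Measurable.pred ?PP far"
    unfolding far_def case_prod_beta'
    by (intro pred_intros_finite pred_intros_logic borel_measurable_le borel_measurable_const
        borel_measurable_norm borel_measurable_diff comp1 comp2) (use ij in auto)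
  have [measurable]: "Measurable.pred ?PP G"
    unfolding G_def case_prod_beta' prod.collapse by measurable
  have [measurable]: "T \<in> measurable ?PP ?C"
    unfolding T_def case_prod_beta' prod.collapse
  proof (rule measurable_If)
    show "(\<lambda>z. (fst z)(i := snd z i)) \<in> measurable ?PP ?C"
    proof (rule measurable_fun_upd)
      show "{1..N} = {1..N} \<union> {i}" using ij by auto
      show "(\<lambda>z. snd z i) \<in> measurable ?PP borel" by (rule comp2[OF ij(1)])
    qed measurable
  qed measurable
  define P' where "P' = distr ?PP ?C T"
  have int_P': "(\<integral>\<^sup>+x. h x \<partial>P') = (\<integral>\<^sup>+z. h (T z) \<partial>?PP)" if "h \<in> borel_measurable ?C" for h
    unfolding P'_def by (rule nn_integral_distr) (use that in measurable)
  have "P' \<in> transport_plans N \<rho>"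
    unfolding transport_plans_def
  proof (intro CollectI conjI ballI)
    show "P' \<in> space (prob_algebra ?C)"
      unfolding space_prob_algebra P'_def by (auto intro!: PP.prob_space_distr)
  next
    fix k assume k: "k \<in> {1..N}"
    have "emeasure (distr P' borel (\<lambda>x. x k)) A = emeasure (distr P borel (\<lambda>x. x k)) A"
      if A [measurable]: "A \<in> sets borel" for A
    proof -
      define h where "h = (\<lambda>x. indicator A (x k) :: ennreal)"
      have [measurable]: "h \<in> borel_measurable ?C"
        unfolding h_def by (rule measurable_compose[OF comp[OF k]]) simp
      have h: "emeasure (distr Q borel (\<lambda>x. x k)) A = (\<integral>\<^sup>+x. h x \<partial>Q)" if Q: "sets Q = sets ?C" for Q
      proof -
        have [measurable]: "(\<lambda>x. x k) \<in> measurable Q borel"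
          using comp[OF k] by (simp add: measurable_cong_sets[OF Q refl])
        show ?thesis
          unfolding h_def by (simp add: nn_integral_distr flip: nn_integral_indicator)
      qed
      \<comment> \<open>The \<open>k\<close>-th coordinates of the two configurations are either
        kept or interchanged, so \<open>h (T (x, y)) + h (T (y, x)) = h x + h y\<close>
        pointwise.\<close>
      have "2 * (\<integral>\<^sup>+x. h x \<partial>P') = (\<integral>\<^sup>+(x, y). h (T (x, y)) + h (T (y, x)) \<partial>?PP)"
        by (subst int_P', simp, subst P.nn_integral_pair_symmetrize) simp_all
      also have "\<dots> = (\<integral>\<^sup>+(x, y). h (fst (x, y)) + h (fst (y, x)) \<partial>?PP)"
        by (intro nn_integral_cong) (auto simp: T_def h_def G_sym ac_simps)
      also have "\<dots> = 2 * (\<integral>\<^sup>+z. h (fst z) \<partial>?PP)"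
        by (subst P.nn_integral_pair_symmetrize) simp_all
      also have "\<dots> = 2 * (\<integral>\<^sup>+x. h x \<partial>P)"
        by (subst P.nn_integral_pair_fst) simp_all
      finally have "(\<integral>\<^sup>+x. h x \<partial>P') = (\<integral>\<^sup>+x. h x \<partial>P)"
        by (simp add: ennreal_mult_cancel_left)
      then show ?thesis by (simp add: h P'_def)
    qed
    then have "distr P' borel (\<lambda>x. x k) = distr P borel (\<lambda>x. x k)"
      by (intro measure_eqI) auto
    then show "distr P' borel (\<lambda>x. x k) = \<rho>" using transport_plansD(3)[OF P k] by simp
  qed
  then have "min_cost \<phi> N \<rho> \<le> (\<integral>\<^sup>+x. cost \<phi> N x \<partial>P')"
    unfolding min_cost_def by (rule INF_lower)
  then have "2 * min_cost \<phi> N \<rho> \<le> 2 * (\<integral>\<^sup>+x. cost \<phi> N x \<partial>P')"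
    by (rule mult_left_mono) simp
  also have "\<dots> = (\<integral>\<^sup>+(x, y). cost \<phi> N (T (x, y)) + cost \<phi> N (T (y, x)) \<partial>?PP)"
    by (subst int_P', simp, subst P.nn_integral_pair_symmetrize) simp_all
  finally have 1: "2 * min_cost \<phi> N \<rho> \<le> \<dots>" .
  \<comment> \<open>Independence enters here: for fixed \<open>x\<close> the second configuration is
    far from \<open>x\<close> with probability at least \<open>\<delta>\<close>, so
    \<open>\<delta>\<close> times the excess of \<open>e x\<close> over \<open>K\<close> is at most
    that excess integrated over the far pairs.\<close>
  have "\<delta> * (\<integral>\<^sup>+x. e x - ennreal K \<partial>P) = (\<integral>\<^sup>+x. \<delta> * (e x - ennreal K) \<partial>P)"
    by (subst nn_integral_cmult) simp_all
  also have "\<dots> \<le> (\<integral>\<^sup>+x. (\<integral>\<^sup>+y. indicator {z\<in>space ?PP. far z} (x, y) * (e x - ennreal K) \<partial>P) \<partial>P)"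
  proof (intro nn_integral_mono)
    fix x assume x: "x \<in> space P"
    have far_x [measurable]: "{y\<in>space P. far (x, y)} \<in> sets P"
      using measurable_compose[OF measurable_Pair1'[OF x] far_meas] by measurable
    have "\<delta> * (e x - ennreal K) \<le> emeasure P {y\<in>space P. far (x, y)} * (e x - ennreal K)"
      using \<delta>[of x] by (intro mult_right_mono) (simp_all add: far_def space_P)
    also have "\<dots> = (\<integral>\<^sup>+y. indicator {y\<in>space P. far (x, y)} y * (e x - ennreal K) \<partial>P)"
      using far_x by (subst nn_integral_multc) simp_all
    also have "\<dots> = (\<integral>\<^sup>+y. indicator {z\<in>space ?PP. far z} (x, y) * (e x - ennreal K) \<partial>P)"
      using x by (intro nn_integral_cong) (auto simp: indicator_def space_pair_measure)
    finally show "\<delta> * (e x - ennreal K) \<le> \<dots>" .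
  qed
  also have "\<dots> = (\<integral>\<^sup>+z. indicator {z\<in>space ?PP. far z} z * (e (fst z) - ennreal K) \<partial>?PP)"
    by (subst P.nn_integral_fst[symmetric]) simp_all
  finally have 2: "\<delta> * (\<integral>\<^sup>+x. e x - ennreal K \<partial>P) \<le> \<dots>" .
  have "2 * min_cost \<phi> N \<rho> + \<delta> * (\<integral>\<^sup>+x. e x - ennreal K \<partial>P) \<le>
      (\<integral>\<^sup>+(x, y). cost \<phi> N (T (x, y)) + cost \<phi> N (T (y, x)) \<partial>?PP) +
      (\<integral>\<^sup>+z. indicator {z\<in>space ?PP. far z} z * (e (fst z) - ennreal K) \<partial>?PP)"
    by (rule add_mono[OF 1 2])
  also have "\<dots> = (\<integral>\<^sup>+z. cost \<phi> N (T z) + cost \<phi> N (T (snd z, fst z)) +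
      indicator {z\<in>space ?PP. far z} z * (e (fst z) - ennreal K) \<partial>?PP)"
    by (subst nn_integral_add[symmetric]) (simp_all add: case_prod_beta')
  also have "\<dots> \<le> (\<integral>\<^sup>+(x, y). cost \<phi> N (fst (x, y)) + cost \<phi> N (fst (y, x)) \<partial>?PP)"
  proof (intro nn_integral_mono)
    fix z assume z: "z \<in> space ?PP"
    obtain x y where xy: "z = (x, y)" by (cases z)
    have "cost \<phi> N (T (x, y)) + cost \<phi> N (T (y, x)) +
        indicator {z\<in>space ?PP. far z} (x, y) * (e x - ennreal K) \<le> cost \<phi> N x + cost \<phi> N y"
    proof (cases "G (x, y)")
      case True
      then have "cost \<phi> N (T (x, y)) + cost \<phi> N (T (y, x)) + (e x - ennreal K) \<le> cost \<phi> N x + cost \<phi> N y"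
        using cost_swap_le[OF \<phi> ij r, of y x] G_sym[of x y] by (auto simp: T_def G_def far_def e_def)
      then show ?thesis by (auto simp: indicator_def intro: order_trans[rotated] split: if_splits)
    next
      \<comment> \<open>Without an exchange nothing has to be gained: either the pair is not far and
        the indicator vanishes, or \<open>e x\<close> is below \<open>K\<close> and the truncated
        difference vanishes.\<close>
      case False
      then have "indicator {z\<in>space ?PP. far z} (x, y) * (e x - ennreal K) = 0"
        by (auto simp: G_def indicator_def diff_eq_0_iff_ennreal not_le intro: less_imp_le order.strict_trans)
      with False show ?thesis by (simp add: T_def G_sym[of y x])
    qed
    then show "cost \<phi> N (T z) + cost \<phi> N (T (snd z, fst z)) +
        indicator {z\<in>space ?PP. far z} z * (e (fst z) - ennreal K) \<le>
        (case z of (x, y) \<Rightarrow> cost \<phi> N (fst (x, y)) + cost \<phi> N (fst (y, x)))"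
      by (simp add: xy)
  qed
  also have "\<dots> = 2 * (\<integral>\<^sup>+z. cost \<phi> N (fst z) \<partial>?PP)"
    by (subst P.nn_integral_pair_symmetrize) simp_all
  also have "\<dots> = 2 * (\<integral>\<^sup>+x. cost \<phi> N x \<partial>P)"
    by (subst P.nn_integral_pair_fst) simp_all
  finally show ?thesis by (simp add: e_def)
qed

subsection \<open>A plan of finite cost\<close>

text \<open>The cuts are quantiles of the coordinate along \<open>b\<close>. Since hyperplanes carry
  no mass, its distribution function is continuous and attains every level \<open>k / M\<close>
  strictly between 0 and 1. Two non-adjacent slabs are separated by two distinct quantiles, and
  \<open>s\<close> is the smallest gap that can occur.\<close>

lemma exists_separated_slabs:
  fixes \<rho> :: "'a::euclidean_space measure"
  assumes \<rho>: "\<rho> \<in> space (prob_algebra borel)" and b: "b \<in> Basis"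
    and hyp: "\<And>t. measure \<rho> {x. x \<bullet> b = t} = 0" and M: "0 < M"
  shows "\<exists>A s. 0 < s \<and> (\<forall>k<M. A k \<in> sets borel \<and> measure \<rho> (A k) = 1 / real M) \<and>
    (\<forall>X\<in>sets borel. (\<Sum>k<M. measure \<rho> (X \<inter> A k)) = measure \<rho> X) \<and>
    (\<forall>k l x y. k + 1 < l \<longrightarrow> l < M \<longrightarrow> x \<in> A k \<longrightarrow> y \<in> A l \<longrightarrow> s \<le> norm (x - y))"
proof -
  interpret \<rho>: prob_space \<rho> using \<rho> by (simp add: space_prob_algebra)
  have sets_\<rho> [measurable_cong, simp]: "sets \<rho> = sets borel" using \<rho> by (simp add: space_prob_algebra)
  have space_\<rho>: "space \<rho> = UNIV" using sets_eq_imp_space_eq[OF sets_\<rho>] by simp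
  define \<mu> where "\<mu> = distr \<rho> borel (\<lambda>x. x \<bullet> b)"
  interpret \<mu>: real_distribution \<mu>
    unfolding \<mu>_def by (intro real_distribution.intro \<rho>.prob_space_distr real_distribution_axioms.intro) simp_all
  have cdf: "cdf \<mu> t = measure \<rho> {x. x \<bullet> b \<le> t}" for t
    unfolding \<mu>_def cdf_def by (subst measure_distr) (auto simp: space_\<rho> intro!: arg_cong2[where f = measure])
  have cont: "isCont (cdf \<mu>) t" for t
    unfolding \<mu>.isCont_cdf using hyp[of t]
    unfolding \<mu>_def by (subst measure_distr) (auto simp: space_\<rho> vimage_def)
  have "\<exists>t. cdf \<mu> t = u" if u: "0 < u" "u < 1" for u
  proof -
    have "eventually (\<lambda>x. cdf \<mu> x < u) at_bot"
      using \<mu>.cdf_lim_at_bot u by (auto intro: order_tendstoD)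
    then obtain x0 where x0: "cdf \<mu> x0 < u" by (auto simp: eventually_at_bot_linorder)
    have "eventually (\<lambda>x. u < cdf \<mu> x) at_top"
      using \<mu>.cdf_lim_at_top_prob u by (auto intro: order_tendstoD)
    then obtain x1 where x1: "u < cdf \<mu> x1" by (auto simp: eventually_at_top_linorder)
    have "x0 \<le> x1" using x0 x1 \<mu>.cdf_nondecreasing[of x1 x0] by linarith
    then show ?thesis using IVT[of "cdf \<mu>" x0 u x1] x0 x1 cont by auto
  qed
  then have "\<forall>k. \<exists>t. 0 < k \<longrightarrow> k < M \<longrightarrow> cdf \<mu> t = real k / real M" by simp
  then obtain t where t: "\<And>k. 0 < k \<Longrightarrow> k < M \<Longrightarrow> cdf \<mu> (t k) = real k / real M" by metis
  have t_mono: "t k < t l" if "0 < k" "k < l" "l < M" for k l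
  proof (rule ccontr)
    assume "\<not> t k < t l"
    then have "cdf \<mu> (t l) \<le> cdf \<mu> (t k)" by (intro \<mu>.cdf_nondecreasing) simp
    with t[of k] t[of l] that M show False by (simp add: divide_le_cancel)
  qed
  \<comment> \<open>\<open>B k\<close> is the union of the first \<open>k\<close> slabs. The ends
    are set by hand to the empty set and the whole space, because the levels 0 and 1 need not be
    attained at any finite cut.\<close>
  define B where "B = (\<lambda>k. {x. k \<noteq> 0 \<and> (k = M \<or> x \<bullet> b \<le> t k)})"
  have B_sets [measurable]: "B k \<in> sets borel" for k unfolding B_def by measurable
  have B_mono: "B k \<subseteq> B (Suc k)" if "k < M" for k
    using that t_mono[of k "Suc k"] by (force simp: B_def)
  have B_measure: "measure \<rho> (B k) = real k / real M" if k: "k \<le> M" for k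
  proof -
    consider "k = 0" | "k = M" | "0 < k" "k < M" using k by linarith
    then show ?thesis
    proof cases
      case 2
      then have "B k = space \<rho>" using M by (auto simp: B_def space_\<rho>)
      then show ?thesis using 2 M \<rho>.prob_space by simp
    next
      case 3
      then show ?thesis using t[of k] by (simp add: B_def cdf)
    qed (simp add: B_def)
  qed
  define A where "A = (\<lambda>k. B (Suc k) - B k)"
  have A_measure: "measure \<rho> (X \<inter> A k) = measure \<rho> (X \<inter> B (Suc k)) - measure \<rho> (X \<inter> B k)"
    if "k < M" "X \<in> sets borel" for X k
  proof -
    have "X \<inter> A k = (X \<inter> B (Suc k)) - (X \<inter> B k)" by (auto simp: A_def)
    then show ?thesis
      using B_mono[OF that(1)] that(2) by (auto intro!: \<rho>.finite_measure_Diff)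
  qed
  \<comment> \<open>The inserted 1 keeps the set nonempty when \<open>M\<close> is too small for two
    inner cuts.\<close>
  define s where "s = Min (insert 1 ((\<lambda>(k, l). t l - t k) ` {(k, l). 0 < k \<and> k < l \<and> l < M}))"
  have fin: "finite {(k, l). 0 < k \<and> k < l \<and> l < M}"
    by (rule finite_subset[of _ "{..<M} \<times> {..<M}"]) auto
  have "0 < s" unfolding s_def using fin t_mono by (subst Min_gr_iff) auto
  moreover have "measure \<rho> (A k) = 1 / real M" if "k < M" for k
    using A_measure[OF that, of UNIV] B_measure[of k] B_measure[of "Suc k"] that
    by (simp add: diff_divide_distrib[symmetric])
  moreover have "(\<Sum>k<M. measure \<rho> (X \<inter> A k)) = measure \<rho> X" if "X \<in> sets borel" for X
  proof -
    have "(\<Sum>k<M. measure \<rho> (X \<inter> A k)) = (\<Sum>k<M. measure \<rho> (X \<inter> B (Suc k)) - measure \<rho> (X \<inter> B k))"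
      using A_measure that by (intro sum.cong) auto
    also have "\<dots> = measure \<rho> (X \<inter> B M) - measure \<rho> (X \<inter> B 0)"
      by (rule sum_lessThan_telescope)
    also have "\<dots> = measure \<rho> X" using M by (simp add: B_def)
    finally show ?thesis .
  qed
  moreover have "s \<le> norm (x - y)" if "k + 1 < l" "l < M" "x \<in> A k" "y \<in> A l" for k l x y
  proof -
    have "x \<bullet> b \<le> t (k + 1)" "t l < y \<bullet> b" using that by (auto simp: A_def B_def)
    moreover have "s \<le> t l - t (k + 1)"
      unfolding s_def using that fin by (intro Min_le) (auto intro!: image_eqI[where x = "(k + 1, l)"])
    moreover have "\<bar>(x - y) \<bullet> b\<bar> \<le> norm (x - y)" by (rule Basis_le_norm[OF b])
    ultimately show ?thesis by (simp add: inner_diff_left)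
  qed
  ultimately show ?thesis
    by (intro exI[of _ A] exI[of _ s]) (auto simp: A_def)
qed

text \<open>With a uniform starting slab, this makes the slab of each single particle uniform as
  well, which yields the correct marginals.\<close>

lemma bij_betw_add_mod: "0 < M \<Longrightarrow> bij_betw (\<lambda>k. (k + c) mod M) {..<M} {..<M :: nat}"
proof -
  assume M: "0 < M"
  have *: "k = l" if "k < M" "l < M" "(k + c) mod M = (l + c) mod M" for k l
    using that
  proof (induction k l rule: linorder_wlog)
    case (le k l)
    then have "M dvd (l + c) - (k + c)" by (subst mod_eq_dvd_iff_nat[symmetric]) auto
    with le show ?case by (auto dest: dvd_imp_le)
  qed auto
  have "inj_on (\<lambda>k. (k + c) mod M) {..<M}" by (rule inj_onI, rule *) auto
  then show ?thesis
    using M by (intro bij_betw_imageI endo_inj_surj) auto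
qed

text \<open>Reduction modulo the even number \<open>2 * N\<close> keeps the parity of
  \<open>k\<close>, so distinct residues differ by at least 2. They are distinct because
  \<open>2 * (j - i)\<close> lies strictly between 0 and \<open>2 * N\<close>.\<close>

lemma same_parity_mod_separated:
  fixes k i j N :: nat
  assumes "i < j" "j < i + N"
  defines "a \<equiv> (k + 2 * i) mod (2 * N)" and "b \<equiv> (k + 2 * j) mod (2 * N)"
  shows "a + 1 < b \<or> b + 1 < a"
proof -
  have "a \<noteq> b"
  proof
    assume "a = b"
    then have "2 * N dvd (k + 2 * j) - (k + 2 * i)"
      unfolding a_def b_def using assms by (subst mod_eq_dvd_iff_nat[symmetric]) auto
    then show False using assms by (auto dest: dvd_imp_le)
  qed
  moreover have "a mod 2 = k mod 2" "b mod 2 = k mod 2"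
    unfolding a_def b_def by (simp_all add: mod_mod_cancel)
  ultimately show ?thesis by presburger
qed

text \<open>Cut the space into \<open>2N\<close> parallel slabs of equal mass. Choose \<open>k\<close> uniformly and put the
  \<open>i\<close>-th particle, independently of the others, into the slab \<open>k + 2i\<close> (modulo \<open>2N\<close>): no two
  particles lie in the same or in adjacent slabs.\<close>

lemma exists_finite_cost_plan:
  fixes \<rho> :: "'a::euclidean_space measure"
  assumes \<rho>: "\<rho> \<in> space (prob_algebra borel)"
    and hyp: "\<And>b t. b \<in> Basis \<Longrightarrow> measure \<rho> {x. x \<bullet> b = t} = 0"
    and \<phi>: "admissible_potential \<phi>" and N: "0 < N"
  shows "\<exists>P\<in>transport_plans N \<rho>. (\<integral>\<^sup>+x. cost \<phi> N x \<partial>P) < \<infinity>"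
proof -
  note One_nat_def [simp del]
  interpret \<rho>: prob_space \<rho> using \<rho> by (simp add: space_prob_algebra)
  have sets_\<rho> [measurable_cong, simp]: "sets \<rho> = sets borel" using \<rho> by (simp add: space_prob_algebra)
  define M where "M = 2 * N"
  have M: "0 < M" using N by (simp add: M_def)
  obtain b :: 'a where "b \<in> Basis" using nonempty_Basis by blast
  from exists_separated_slabs[OF \<rho> this hyp[OF this] M] obtain A s where s: "0 < s"
    and A_sets [measurable]: "\<And>k. k < M \<Longrightarrow> A k \<in> sets borel"
    and A_measure: "\<And>k. k < M \<Longrightarrow> measure \<rho> (A k) = 1 / real M"
    and A_sum: "\<And>X. X \<in> sets borel \<Longrightarrow> (\<Sum>k<M. measure \<rho> (X \<inter> A k)) = measure \<rho> X"
    and A_sep: "\<And>k l x y. k + 1 < l \<Longrightarrow> l < M \<Longrightarrow> x \<in> A k \<Longrightarrow> y \<in> A l \<Longrightarrow> s \<le> norm (x - y)"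
    by metis
  define I where "I = {1..N}"
  have I: "finite I" "card I = N" by (simp_all add: I_def)
  let ?C = "config_space N :: (nat \<Rightarrow> 'a) measure"
  define R where "R = PiM I (\<lambda>_. \<rho>)"
  interpret R: product_sigma_finite "\<lambda>_::nat. \<rho>" ..
  have sets_R [measurable_cong, simp]: "sets R = sets ?C"
    unfolding R_def I_def by (intro sets_PiM_cong) simp_all
  have space_R: "space R = space ?C" using sets_R by (rule sets_eq_imp_space_eq)
  define idx where "idx = (\<lambda>k i :: nat. (k + 2 * i) mod M)"
  have idx: "idx k i < M" for k i using M by (simp add: idx_def)
  have comp: "(\<lambda>x. x i) \<in> measurable ?C borel" if "i \<in> I" for i
    using that by (simp add: I_def)
  have ind: "(\<lambda>x. indicator X (x i) :: ennreal) \<in> borel_measurable ?C"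
    if "i \<in> I" "X \<in> sets borel" for i X
    by (rule measurable_compose[OF comp[OF that(1)]]) (use that(2) in simp)
  \<comment> \<open>Conditioning each of the \<open>N\<close> particles on a slab of mass
    \<open>1 / M\<close> gives the factor \<open>M ^ N\<close>; the uniform choice of
    \<open>k\<close> removes one power.\<close>
  define h where "h = (\<lambda>x. ennreal (real M ^ (N - 1)) * (\<Sum>k<M. \<Prod>i\<in>I. indicator (A (idx k i)) (x i)))"
  have h [measurable]: "h \<in> borel_measurable ?C"
    unfolding h_def
    by (intro borel_measurable_times_ennreal borel_measurable_const borel_measurable_sum
        borel_measurable_prod_ennreal ind A_sets idx) auto
  define P where "P = density R h"
  have sets_P [measurable_cong, simp]: "sets P = sets ?C" by (simp add: P_def)
  have marginal: "emeasure (distr P borel (\<lambda>x. x j)) X = emeasure \<rho> X"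
    if j: "j \<in> I" and X: "X \<in> sets borel" for j X
  proof -
    note [measurable] = ind[OF j X]
    have jP: "(\<lambda>x. x j) \<in> measurable P borel"
      using comp[OF j] by (simp add: measurable_cong_sets[OF sets_P refl])
    \<comment> \<open>Intersecting the \<open>j\<close>-th side of each box with \<open>X\<close>
      keeps the integrand a sum of products, so the integral factorizes.\<close>
    define Y where "Y = (\<lambda>k i. if i = j then X \<inter> A (idx k i) else A (idx k i))"
    have Y_sets: "Y k i \<in> sets borel" for k i using A_sets[OF idx] X by (auto simp: Y_def)
    have Y_int: "(\<integral>\<^sup>+x. (\<Prod>i\<in>I. indicator (Y k i) (x i)) \<partial>R) =
        ennreal (measure \<rho> (X \<inter> A (idx k j)) * (1 / real M) ^ (N - 1))" for k
    proof -
      have "(\<integral>\<^sup>+x. (\<Prod>i\<in>I. indicator (Y k i) (x i)) \<partial>R) = (\<Prod>i\<in>I. \<integral>\<^sup>+x. indicator (Y k i) x \<partial>\<rho>)"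
        unfolding R_def using Y_sets I by (intro R.product_nn_integral_prod) auto
      also have "\<dots> = (\<Prod>i\<in>I. ennreal (measure \<rho> (Y k i)))"
        using Y_sets by (simp add: \<rho>.emeasure_eq_measure)
      also have "\<dots> = ennreal (\<Prod>i\<in>I. measure \<rho> (Y k i))" by (simp add: prod_ennreal)
      also have "(\<Prod>i\<in>I. measure \<rho> (Y k i)) =
          measure \<rho> (Y k j) * (\<Prod>i\<in>I - {j}. measure \<rho> (Y k i))"
        using I j by (simp add: prod.remove)
      also have "(\<Prod>i\<in>I - {j}. measure \<rho> (Y k i)) = (\<Prod>i\<in>I - {j}. 1 / real M)"
        by (intro prod.cong) (auto simp: Y_def A_measure idx)
      finally show ?thesis using I j by (simp add: Y_def)
    qed
    have "emeasure (distr P borel (\<lambda>x. x j)) X = (\<integral>\<^sup>+x. indicator X x \<partial>distr P borel (\<lambda>x. x j))"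
      using X by simp
    also have "\<dots> = (\<integral>\<^sup>+x. indicator X (x j) \<partial>P)"
      using X by (intro nn_integral_distr jP) simp
    also have "\<dots> = (\<integral>\<^sup>+x. h x * indicator X (x j) \<partial>R)"
      unfolding P_def by (intro nn_integral_density) simp_all
    also have "\<dots> = (\<integral>\<^sup>+x. ennreal (real M ^ (N - 1)) * (\<Sum>k<M. \<Prod>i\<in>I. indicator (Y k i) (x i)) \<partial>R)"
    proof (intro nn_integral_cong)
      fix x
      have "(\<Prod>i\<in>I. indicator (A (idx k i)) (x i)) * indicator X (x j) =
          (\<Prod>i\<in>I. indicator (Y k i) (x i) :: ennreal)" for k
      proof -
        have "(\<Prod>i\<in>I. indicator (Y k i) (x i) :: ennreal) =
            indicator (Y k j) (x j) * (\<Prod>i\<in>I - {j}. indicator (Y k i) (x i))"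
          using I j by (simp add: prod.remove)
        also have "(\<Prod>i\<in>I - {j}. indicator (Y k i) (x i) :: ennreal) =
            (\<Prod>i\<in>I - {j}. indicator (A (idx k i)) (x i))"
          by (intro prod.cong) (auto simp: Y_def)
        finally show ?thesis
          using I j by (simp add: prod.remove[of I j] Y_def indicator_inter_arith ac_simps)
      qed
      then show "h x * indicator X (x j) =
          ennreal (real M ^ (N - 1)) * (\<Sum>k<M. \<Prod>i\<in>I. indicator (Y k i) (x i))"
        by (simp add: h_def mult.assoc sum_distrib_right)
    qed
    also have "\<dots> = ennreal (real M ^ (N - 1)) * (\<Sum>k<M. \<integral>\<^sup>+x. (\<Prod>i\<in>I. indicator (Y k i) (x i)) \<partial>R)"
    proof -
      have *: "(\<lambda>x. \<Prod>i\<in>I. indicator (Y k i) (x i) :: ennreal) \<in> borel_measurable R" for k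
        using ind Y_sets by (intro borel_measurable_prod_ennreal) (simp add: measurable_cong_sets[OF sets_R refl])
      then show ?thesis by (simp add: nn_integral_cmult nn_integral_sum)
    qed
    also have "\<dots> = ennreal (real M ^ (N - 1) * (\<Sum>k<M. measure \<rho> (X \<inter> A (idx k j)) * (1 / real M) ^ (N - 1)))"
      unfolding Y_int by (subst sum_ennreal) (simp_all add: ennreal_mult sum_nonneg)
    also have "real M ^ (N - 1) * (\<Sum>k<M. measure \<rho> (X \<inter> A (idx k j)) * (1 / real M) ^ (N - 1)) =
        (\<Sum>k<M. measure \<rho> (X \<inter> A (idx k j)))"
      using M by (simp add: sum_distrib_left power_one_over)
    \<comment> \<open>As \<open>k\<close> runs through all slabs, so does the slab of particle
      \<open>j\<close>, and the pieces of \<open>X\<close> add up to its full mass.\<close>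
    also have "\<dots> = (\<Sum>k<M. measure \<rho> (X \<inter> A k))"
      unfolding idx_def
      by (rule sum.reindex_bij_betw[OF bij_betw_add_mod[OF M], of "\<lambda>k. measure \<rho> (X \<inter> A k)"])
    also have "\<dots> = measure \<rho> X" by (rule A_sum[OF X])
    finally show ?thesis by (simp add: \<rho>.emeasure_eq_measure)
  qed
  have distr_P: "distr P borel (\<lambda>x. x j) = \<rho>" if "j \<in> I" for j
    by (rule measure_eqI) (use marginal[OF that] in auto)
  have "prob_space P"
  proof
    have 1: "1 \<in> I" using N by (auto simp: I_def)
    have "(\<lambda>x. x 1) \<in> measurable P borel"
      using comp[OF 1] by (simp add: measurable_cong_sets[OF sets_P refl])
    then have "emeasure P (space P) = emeasure (distr P borel (\<lambda>x. x 1)) UNIV"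
      by (subst emeasure_distr) (auto intro!: arg_cong2[where f = emeasure])
    also have "\<dots> = 1"
      using \<rho>.emeasure_space_1 sets_eq_imp_space_eq[OF sets_\<rho>] by (simp add: distr_P[OF 1])
    finally show "emeasure P (space P) = 1" .
  qed
  then interpret P: prob_space P .
  have "P \<in> transport_plans N \<rho>"
    unfolding transport_plans_def space_prob_algebra using P.prob_space_axioms distr_P
    by (auto simp: I_def)
  moreover have "(\<integral>\<^sup>+x. cost \<phi> N x \<partial>P) < \<infinity>"
  proof -
    define K where "K = (\<Sum>i\<in>{1..N}. \<Sum>j\<in>{i<..N}. ennreal (\<phi> s))"
    \<comment> \<open>Where the density is positive, some product is nonzero, so all particles
      occupy the slabs assigned by one \<open>k\<close> and any two are at distance at least
      \<open>s\<close>.\<close>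
    have "cost \<phi> N x \<le> K" if "h x > 0" for x
    proof -
      have "\<exists>k<M. (\<Prod>i\<in>I. indicator (A (idx k i)) (x i) :: ennreal) \<noteq> 0"
      proof (rule ccontr)
        assume "\<not> (\<exists>k<M. (\<Prod>i\<in>I. indicator (A (idx k i)) (x i) :: ennreal) \<noteq> 0)"
        then have "h x = 0" unfolding h_def by (subst sum.neutral) auto
        with that show False by simp
      qed
      then obtain k where k: "\<And>i. i \<in> I \<Longrightarrow> x i \<in> A (idx k i)"
        using I by (auto simp: prod_zero_iff indicator_eq_0_iff)
      have "s \<le> norm (x i - x j)" if ij: "i \<in> {1..N}" "j \<in> {i<..N}" for i j
      proof -
        have "i < j" "j < i + N" using ij by auto
        from same_parity_mod_separated[OF this, of k]
        have "idx k i + 1 < idx k j \<or> idx k j + 1 < idx k i" by (simp add: idx_def M_def)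
        moreover have "x i \<in> A (idx k i)" "x j \<in> A (idx k j)" using ij by (auto intro!: k simp: I_def)
        ultimately show ?thesis
          using A_sep[of "idx k i" "idx k j" "x i" "x j"] A_sep[of "idx k j" "idx k i" "x j" "x i"] idx
          by (auto simp: norm_minus_commute)
      qed
      then show ?thesis
        unfolding cost_def K_def by (intro sum_mono ext_potential_antimono[OF \<phi> s])
    qed
    then have "AE x in P. cost \<phi> N x \<le> K"
      unfolding P_def by (subst AE_density) (auto intro!: AE_I2)
    then have "(\<integral>\<^sup>+x. cost \<phi> N x \<partial>P) \<le> (\<integral>\<^sup>+x. K \<partial>P)" by (rule nn_integral_mono_AE)
    also have "\<dots> = K" by (simp add: P.emeasure_space_1)
    also have "K < \<infinity>" by (simp add: K_def ennreal_mult_less_top of_nat_less_top)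
    finally show ?thesis .
  qed
  ultimately show ?thesis by blast
qed

subsection \<open>Mass of small balls\<close>

text \<open>\<open>ennreal\<close> sends nonpositive reals to 0, whose inverse is infinite, so the
  identity forces \<open>p'\<close> to be positive and can then be read in the reals. An infinite
  \<open>p\<close> contributes 0 to the sum.\<close>

lemma conjugate_exponent_cases:
  assumes "1 < p" "inverse p + inverse (ennreal p') = 1"
  obtains "p = \<infinity>" "p' = 1"
    | q where "p = ennreal q" "1 < q" "1 < p'" "1 / q + 1 / p' = 1"
proof -
  have p': "0 < p'"
  proof (rule ccontr)
    assume "\<not> 0 < p'"
    then have "ennreal p' = 0" by (simp add: ennreal_neg)
    with assms show False by simp
  qed
  show ?thesis
  proof (cases p)
    case (real q)
    then have q: "1 < q" using assms(1) by (metis ennreal_1 ennreal_less_iff zero_le_one)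
    have "ennreal (inverse q + inverse p') = ennreal 1"
      using assms(2) real q p' by (simp add: inverse_ennreal ennreal_plus)
    then have *: "inverse q + inverse p' = 1" using q p' by (subst (asm) ennreal_inj) auto
    moreover have "0 < inverse q" using q by simp
    ultimately have "inverse p' < 1" by linarith
    then have "1 < p'" using p' by (simp add: inverse_less_1_iff)
    with real q * show ?thesis by (intro that(2)[of q]) (auto simp: inverse_eq_divide)
  next
    case top
    then have "ennreal (inverse p') = ennreal 1"
      using assms(2) p' by (simp add: inverse_ennreal)
    then have "inverse p' = 1" using p' by (subst (asm) ennreal_inj) auto
    with top show ?thesis by (intro that(1)) (auto simp: inverse_eq_1_iff)
  qed
qed

text \<open>Otherwise \<open>f\<close> would vanish almost everywhere and \<open>\<rho>\<close>
  would have total mass 0. Positivity keeps the denominator in \<open>critical_radius\<close> away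
  from 0.\<close>

lemma Lp_norm_pos:
  fixes f :: "'a::euclidean_space \<Rightarrow> real"
  assumes p: "1 < p" and f: "prob_with_Lp_density p \<rho> f"
  shows "0 < Lp_norm p f"
proof (rule ccontr)
  assume neg: "\<not> 0 < Lp_norm p f"
  have [measurable]: "f \<in> borel_measurable borel"
    using f by (simp add: prob_with_Lp_density_def in_Lp_def)
  have "AE x in lborel. f x = 0"
  proof (cases "p = \<infinity>")
    case True
    let ?S = "esssup lborel (\<lambda>x. ennreal \<bar>f x\<bar>)"
    have "enn2real ?S = 0" "?S < \<infinity>"
      using neg f True by (auto simp: Lp_norm_def prob_with_Lp_density_def in_Lp_def not_less antisym)
    then have "?S = 0" by (auto simp: enn2real_eq_0_iff)
    then have "AE x in lborel. ennreal \<bar>f x\<bar> \<le> 0"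
      using esssup_AE[of "\<lambda>x. ennreal \<bar>f x\<bar>" lborel] by simp
    then show ?thesis by eventually_elim simp
  next
    case False
    let ?g = "\<lambda>x. \<bar>f x\<bar> powr enn2real p"
    have int: "integrable lborel ?g"
      using f False by (simp add: prob_with_Lp_density_def in_Lp_def)
    have "integral\<^sup>L lborel ?g = 0"
      using neg False by (auto simp: Lp_norm_def)
    then have "AE x in lborel. ?g x = 0"
      using integral_nonneg_eq_0_iff_AE[OF int] by simp
    then show ?thesis by eventually_elim simp
  qed
  then have "(\<integral>\<^sup>+x. ennreal (f x) \<partial>lborel) = 0"
    by (subst nn_integral_0_iff_AE) (auto elim: eventually_mono)
  moreover have "emeasure \<rho> (space \<rho>) = (\<integral>\<^sup>+x. ennreal (f x) \<partial>lborel)"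
    using f by (simp add: prob_with_Lp_density_def emeasure_density)
  moreover have "emeasure \<rho> (space \<rho>) = 1"
    using f prob_space.emeasure_space_1[of \<rho>] by (auto simp: prob_with_Lp_density_def space_prob_algebra)
  ultimately show False by simp
qed

text \<open>Hoelder's inequality for \<open>f\<close> and the indicator of \<open>B\<close>. For
  finite \<open>p\<close> it comes from Young's inequality, applied pointwise to both functions
  after scaling them to norm 1.\<close>

lemma emeasure_Lp_density_le:
  fixes f :: "'a::euclidean_space \<Rightarrow> real"
  assumes p: "1 < p" "inverse p + inverse (ennreal p') = 1"
    and f: "prob_with_Lp_density p \<rho> f"
    and B [measurable]: "B \<in> sets borel" and B_fin: "emeasure lborel B < \<infinity>"
  shows "emeasure \<rho> B \<le> ennreal (Lp_norm p f * measure lborel B powr (1 / p'))"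
proof -
  define V where "V = measure lborel B"
  have V: "emeasure lborel B = ennreal V"
    using B_fin unfolding V_def by (intro emeasure_eq_ennreal_measure) auto
  have f_meas [measurable]: "f \<in> borel_measurable borel"
    using f by (simp add: prob_with_Lp_density_def in_Lp_def)
  have \<rho>B: "emeasure \<rho> B = (\<integral>\<^sup>+x. ennreal (f x) * indicator B x \<partial>lborel)"
    using f by (simp add: prob_with_Lp_density_def emeasure_density)
  define F where "F = Lp_norm p f"
  have F: "0 < F" unfolding F_def by (rule Lp_norm_pos[OF p(1) f])
  have "emeasure \<rho> B \<le> ennreal (F * V powr (1 / p'))"
    using p
  proof (cases rule: conjugate_exponent_cases)
    case 1
    let ?S = "esssup lborel (\<lambda>x. ennreal \<bar>f x\<bar>)"
    have S: "?S = ennreal F"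
      using f 1 by (simp add: F_def Lp_norm_def prob_with_Lp_density_def in_Lp_def less_top[symmetric])
    have "AE x in lborel. ennreal \<bar>f x\<bar> \<le> ennreal F"
      using esssup_AE[of "\<lambda>x. ennreal \<bar>f x\<bar>" lborel] unfolding S .
    then have "AE x in lborel. ennreal (f x) * indicator B x \<le> ennreal F * indicator B x"
      by eventually_elim (auto intro!: mult_right_mono intro: order_trans[rotated] ennreal_leI)
    then have "emeasure \<rho> B \<le> (\<integral>\<^sup>+x. ennreal F * indicator B x \<partial>lborel)"
      unfolding \<rho>B by (rule nn_integral_mono_AE)
    also have "\<dots> = ennreal (F * V)"
      using F by (simp add: nn_integral_cmult_indicator V ennreal_mult V_def)
    finally show ?thesis using 1 by (simp add: V_def)
  next
    case (2 q)
    show ?thesis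
    proof (cases "V = 0")
      \<comment> \<open>The indicator of a null set cannot be scaled to norm 1, so this case is
        separate.\<close>
      case True
      then have "AE x in lborel. x \<notin> B"
        using V by (intro AE_not_in) (auto simp: null_sets_def)
      then have "AE x in lborel. ennreal (f x) * indicator B x = 0"
        by eventually_elim simp
      then have "emeasure \<rho> B = 0" unfolding \<rho>B by (subst nn_integral_0_iff_AE) auto
      then show ?thesis by simp
    next
      case False
      then have V_pos: "0 < V" by (simp add: V_def zero_less_measure_iff)
      define I where "I = (LINT x|lborel. \<bar>f x\<bar> powr q)"
      have int: "integrable lborel (\<lambda>x. \<bar>f x\<bar> powr q)"
        using f 2 by (simp add: prob_with_Lp_density_def in_Lp_def)
      have FI: "F = I powr (1 / q)" using 2 by (simp add: F_def Lp_norm_def I_def)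
      have "0 \<le> I" unfolding I_def by (intro integral_nonneg_AE) simp
      then have I: "0 < I" using F by (cases "I = 0") (auto simp: FI)
      have Fq: "F powr q = I" using I 2 by (simp add: FI powr_powr)
      define c where "c = F * V powr (1 / p')"
      have c: "0 < c" using F V_pos by (simp add: c_def)
      \<comment> \<open>Young's majorant of the product of the scaled functions, multiplied back by
        the norms. The bracket integrates to \<open>1 / q + 1 / p' = 1\<close>, leaving
        \<open>c\<close>.\<close>
      let ?g = "\<lambda>x. c * (\<bar>f x\<bar> powr q / (I * q) + indicator B x / (V * p'))"
      have int_B: "integrable lborel (indicator B :: 'a \<Rightarrow> real)"
        using V by (intro integrable_real_indicator) auto
      have int_g: "integrable lborel ?g" using int int_B by simp
      have g_nonneg: "0 \<le> ?g x" for x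
        using c I V_pos 2 by (intro mult_nonneg_nonneg add_nonneg_nonneg divide_nonneg_nonneg) auto
      have le: "ennreal (f x) * indicator B x \<le> ennreal (?g x)" for x
      proof (cases "x \<in> B")
        case True
        have "(\<bar>f x\<bar> / F) * (1 / V powr (1 / p')) \<le>
            (\<bar>f x\<bar> / F) powr q / q + (1 / V powr (1 / p')) powr p' / p'"
          using 2 F V_pos by (intro Youngs_inequality) auto
        also have "(\<bar>f x\<bar> / F) powr q = \<bar>f x\<bar> powr q / I"
          using F by (simp add: powr_divide Fq)
        also have "(1 / V powr (1 / p')) powr p' = 1 / V"
          using V_pos 2 by (simp add: powr_divide powr_powr)
        finally have "\<bar>f x\<bar> / c \<le> \<bar>f x\<bar> powr q / (I * q) + 1 / (V * p')"
          by (simp add: c_def)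
        then have "\<bar>f x\<bar> \<le> ?g x" using c True by (simp add: pos_divide_le_eq mult.commute)
        then have "f x \<le> ?g x" by linarith
        then show ?thesis using True by (simp add: ennreal_leI)
      qed simp
      have "emeasure \<rho> B \<le> (\<integral>\<^sup>+x. ennreal (?g x) \<partial>lborel)"
        unfolding \<rho>B by (intro nn_integral_mono le)
      also have "\<dots> = ennreal (integral\<^sup>L lborel ?g)"
        by (intro nn_integral_eq_integral int_g) (simp add: g_nonneg)
      also have "integral\<^sup>L lborel ?g = c * (I / (I * q) + V / (V * p'))"
        using int int_B by (simp add: I_def V_def)
      also have "\<dots> = c" using I V_pos 2 by simp
      finally show ?thesis by (simp add: c_def)
    qed
  qed
  then show ?thesis by (simp add: F_def V_def)
qed

lemma measure_hyperplane_eq_0: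
  fixes f :: "'a::euclidean_space \<Rightarrow> real"
  assumes p: "1 < p" "inverse p + inverse (ennreal p') = 1"
    and f: "prob_with_Lp_density p \<rho> f" and b: "b \<in> Basis"
  shows "measure \<rho> {x. x \<bullet> b = t} = 0"
proof -
  let ?H = "{x::'a. x \<bullet> b = t}"
  have H: "?H \<in> sets borel" by measurable
  have "?H \<in> null_sets lebesgue"
    using negligible_standard_hyperplane[OF b] by (simp add: negligible_iff_null_sets)
  then have "emeasure lborel ?H = 0" using H by (simp add: null_sets_completion_iff null_sets_def)
  then have "emeasure \<rho> ?H \<le> 0"
    using emeasure_Lp_density_le[OF p f H] by (simp add: measure_def)
  then show ?thesis by (simp add: measure_def)
qed

lemma critical_radius_pos:
  fixes f :: "'a::euclidean_space \<Rightarrow> real"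
  assumes "1 < N" "1 < p" "prob_with_Lp_density p \<rho> f"
  shows "0 < critical_radius N p p' f"
proof -
  have "unit_ball_vol (real DIM('a)) \<noteq> 0" by (rule less_imp_neq[symmetric]) simp
  then show ?thesis
    using assms(1) Lp_norm_pos[OF assms(2,3)] by (auto simp: critical_radius_def content_ball)
qed

text \<open>The critical radius is the one at which Hoelder's bound for the mass of a ball equals
  \<open>1 / (N (N - 1)\<^sup>2)\<close>. The bound increases strictly with the radius and does not
  depend on the centre.\<close>

lemma emeasure_ball_critical:
  fixes f :: "'a::euclidean_space \<Rightarrow> real"
  assumes N: "1 < N" and p: "1 < p" "inverse p + inverse (ennreal p') = 1"
    and f: "prob_with_Lp_density p \<rho> f"
    and s: "0 < s" "s < critical_radius N p p' f"
  obtains c where "0 \<le> c" "c < 1 / (real N * (real N - 1)\<^sup>2)"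
    "\<And>x. emeasure \<rho> (ball x s) \<le> ennreal c"
proof -
  let ?d = "DIM('a)"
  define \<omega> where "\<omega> = measure lborel (ball (0::'a) 1)"
  have ball: "measure lborel (ball x s) = \<omega> * s ^ ?d" for x :: 'a
    using s by (simp add: \<omega>_def content_ball)
  have \<omega>: "0 < \<omega>" by (simp add: \<omega>_def content_ball)
  define F where "F = Lp_norm p f"
  have F: "0 < F" unfolding F_def by (rule Lp_norm_pos[OF p(1) f])
  define n where "n = real N * (real N - 1)\<^sup>2"
  have n: "0 < n" using N by (simp add: n_def)
  have p': "0 < p'" using p by (cases rule: conjugate_exponent_cases) auto
  have d: "0 < real ?d" by simp
  define R where "R = 1 / (\<omega> * n powr p' * F powr p')"
  have R: "0 < R" using \<omega> n F by (simp add: R_def)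
  have "s powr real ?d < (R powr (1 / real ?d)) powr real ?d"
    using s d by (intro powr_less_mono2) (auto simp: critical_radius_def R_def \<omega>_def n_def F_def)
  then have "s ^ ?d < R" using R s d by (simp add: powr_powr powr_realpow)
  then have "\<omega> * s ^ ?d < \<omega> * R" using \<omega> by simp
  also have "\<omega> * R = (1 / (n * F)) powr p'"
    using \<omega> n F by (simp add: R_def powr_divide powr_mult)
  finally have "(\<omega> * s ^ ?d) powr (1 / p') < ((1 / (n * F)) powr p') powr (1 / p')"
    using \<omega> s p' by (intro powr_less_mono2) auto
  also have "\<dots> = 1 / (n * F)" using n F p' by (simp add: powr_powr)
  finally have "F * (\<omega> * s ^ ?d) powr (1 / p') < F * (1 / (n * F))"
    by (rule mult_strict_left_mono[OF _ F])
  also have "\<dots> = 1 / n" using F by simp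
  finally have "F * (\<omega> * s ^ ?d) powr (1 / p') < 1 / n" .
  moreover have "emeasure \<rho> (ball x s) \<le> ennreal (F * (\<omega> * s ^ ?d) powr (1 / p'))" for x
    using emeasure_Lp_density_le[OF p f, of "ball x s"] emeasure_ball[of s x] s
    by (simp add: ball F_def)
  ultimately show ?thesis using F by (intro that[of "F * (\<omega> * s ^ ?d) powr (1 / p')"]) (auto simp: n_def)
qed

text \<open>As \<open>K\<close> is strictly above the threshold and \<open>\<phi>\<close> is
  continuous, the radius can be taken slightly below the critical one, where the ball estimate is
  strict and \<open>\<delta>\<close> positive. The quantifier order matters: \<open>\<delta>\<close>
  is fixed before the plan, so that it serves along a minimizing sequence.\<close>

lemma min_cost_exchange_critical:
  fixes \<rho> :: "'a::euclidean_space measure" and f :: "'a \<Rightarrow> real"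
  assumes N: "1 < N" and \<phi>: "admissible_potential \<phi>"
    and p: "1 < p" "inverse p + inverse (ennreal p') = 1"
    and f: "prob_with_Lp_density p \<rho> f"
    and K: "2 * (real N - 1) * \<phi> (critical_radius N p p' f) < K"
  shows "\<exists>\<delta>::real>0. \<forall>P\<in>transport_plans N \<rho>. \<forall>i\<in>{1..N}. \<forall>j\<in>{1..N} - {i}.
      2 * min_cost \<phi> N \<rho> +
        ennreal \<delta> * (\<integral>\<^sup>+x. ext_potential \<phi> (norm (x i - x j)) - ennreal K \<partial>P) \<le>
      2 * (\<integral>\<^sup>+x. cost \<phi> N x \<partial>P)"
proof -
  let ?r = "critical_radius N p p' f"
  have r: "0 < ?r" by (rule critical_radius_pos[OF N p(1) f])
  have "isCont \<phi> ?r"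
    using \<phi> r by (auto simp: admissible_potential_def continuous_on_eq_continuous_at)
  then have "(\<phi> \<longlongrightarrow> \<phi> ?r) (at_left ?r)"
    by (simp add: isCont_def filterlim_at_split)
  then have "((\<lambda>s. 2 * (real N - 1) * \<phi> s) \<longlongrightarrow> 2 * (real N - 1) * \<phi> ?r) (at_left ?r)"
    by (rule tendsto_mult_left)
  then have "eventually (\<lambda>s. 2 * (real N - 1) * \<phi> s < K) (at_left ?r)"
    using K by (rule order_tendstoD)
  moreover have "eventually (\<lambda>s. s \<in> {0<..<?r}) (at_left ?r)"
    using r by (rule eventually_at_left_real)
  ultimately have "eventually (\<lambda>s. 2 * (real N - 1) * \<phi> s < K \<and> s \<in> {0<..<?r}) (at_left ?r)"
    by eventually_elim simp
  then obtain s where s: "2 * (real N - 1) * \<phi> s < K" "0 < s" "s < ?r"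
    using eventually_happens'[OF trivial_limit_at_left_real] by auto
  obtain c where c: "0 \<le> c" "c < 1 / (real N * (real N - 1)\<^sup>2)"
    "\<And>x. emeasure \<rho> (ball x s) \<le> ennreal c"
    using emeasure_ball_critical[OF N p f s(2,3)] by metis
  \<comment> \<open>For \<open>N = 2\<close> the final bound \<open>2 / (N (N - 1))\<close> equals
    1, so positivity of \<open>\<delta>\<close> rests on this strict inequality.\<close>
  have "2 * (real N - 1) * c < 2 * (real N - 1) * (1 / (real N * (real N - 1)\<^sup>2))"
    using N c(2) by (intro mult_strict_left_mono) auto
  also have "\<dots> = 2 / (real N * (real N - 1))"
  proof -
    have *: "2 * m * (1 / (n * m\<^sup>2)) = 2 / (n * m)" if "m \<noteq> 0" for m n :: real
      using that by (simp add: power2_eq_square)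
    show ?thesis using N by (intro *) simp
  qed
  also have "\<dots> \<le> 1"
  proof -
    have "2 * 1 \<le> real N * (real N - 1)" using N by (intro mult_mono) auto
    then show ?thesis using N by (simp add: divide_le_eq)
  qed
  finally have \<delta>: "0 < 1 - 2 * (real N - 1) * c" by simp
  show ?thesis
  proof (intro exI conjI ballI)
    show "0 < 1 - 2 * (real N - 1) * c" by (rule \<delta>)
  next
    fix P i j assume "P \<in> transport_plans N \<rho>" "i \<in> {1..N}" "j \<in> {1..N} - {i}"
    then show "2 * min_cost \<phi> N \<rho> + ennreal (1 - 2 * (real N - 1) * c) *
          (\<integral>\<^sup>+x. ext_potential \<phi> (norm (x i - x j)) - ennreal K \<partial>P) \<le>
        2 * (\<integral>\<^sup>+x. cost \<phi> N x \<partial>P)"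
      using s c by (intro min_cost_exchange[where r = s] emeasure_far_ge \<phi>) auto
  qed
qed

subsection \<open>Consequences of the exchange inequality\<close>

text \<open>\<open>\<phi>\<close> need not be onto the positive reals, and
  \<open>the_inv_into\<close> is meaningful only on its range. Levels above a value of
  \<open>\<phi>\<close> are attained by the intermediate value theorem, because
  \<open>\<phi>\<close> blows up at 0.\<close>

lemma the_inv_into_potential:
  assumes \<phi>: "admissible_potential \<phi>" and r: "0 < r" "\<phi> r \<le> K"
  shows "\<phi> (the_inv_into {0<..} \<phi> K) = K"
proof -
  have "inj_on \<phi> {0<..}"
    using \<phi> unfolding admissible_potential_def monotone_on_def inj_on_def
    by (metis less_irrefl linorder_neqE)
  moreover have "K \<in> \<phi> ` {0<..}"
  proof -
    have "eventually (\<lambda>t. K \<le> \<phi> t) (at_right 0)"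
      using \<phi> by (simp add: admissible_potential_def filterlim_at_top)
    moreover have "eventually (\<lambda>t. t \<in> {0<..<r}) (at_right 0)"
      using r by (intro eventually_at_right_real)
    ultimately have "eventually (\<lambda>t. K \<le> \<phi> t \<and> t \<in> {0<..<r}) (at_right 0)"
      by eventually_elim simp
    then obtain t where t: "K \<le> \<phi> t" "0 < t" "t < r"
      using eventually_happens'[OF trivial_limit_at_right_real] by auto
    have "continuous_on {t..r} \<phi>"
      using \<phi> t by (auto simp: admissible_potential_def intro: continuous_on_subset)
    then obtain u where "t \<le> u" "u \<le> r" "\<phi> u = K"
      using IVT2'[of \<phi> r K t] r t by auto
    then show ?thesis using t by (intro image_eqI[of _ _ u]) auto
  qed
  ultimately show ?thesis by (rule f_the_inv_into_f)
qed

text \<open>A mean excess of at most \<open>\<epsilon>\<close> over \<open>K + \<epsilon>\<close>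
  bounds the mean cost of each pair by \<open>K + 2 \<epsilon>\<close>. Summing over the
  \<open>N (N - 1) / 2\<close> pairs and letting \<open>\<epsilon>\<close> tend to 0 gives the
  claim, with a plan that may change with \<open>\<epsilon>\<close>.\<close>

lemma min_cost_le_pairs:
  assumes N: "0 < N"
    and near: "\<And>\<epsilon>. 0 < \<epsilon> \<Longrightarrow> \<exists>P\<in>transport_plans N \<rho>.
      \<forall>i\<in>{1..N}. \<forall>j\<in>{i<..N}. (\<integral>\<^sup>+x. ext_potential \<phi> (norm (x i - x j)) - ennreal (K + \<epsilon>) \<partial>P) \<le> ennreal \<epsilon>"
    and K: "0 \<le> K" and \<phi>: "admissible_potential \<phi>"
  shows "min_cost \<phi> N (\<rho> :: 'a::euclidean_space measure) \<le> ennreal (real N * (real N - 1) / 2 * K)"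
proof (rule ennreal_le_epsilon)
  fix \<eta> :: real assume \<eta>: "0 < \<eta>"
  define Q where "Q = real N * (real N - 1) / 2"
  have Q: "0 \<le> Q" using N by (simp add: Q_def)
  \<comment> \<open>Chosen so that the total error \<open>2 * Q * \<epsilon>\<close> is at most
    \<open>\<eta>\<close>; adding 1 avoids division by 0.\<close>
  define \<epsilon> where "\<epsilon> = \<eta> / (2 * (Q + 1))"
  have \<epsilon>: "0 < \<epsilon>" using \<eta> Q by (simp add: \<epsilon>_def)
  obtain P where P: "P \<in> transport_plans N \<rho>" and int: "\<And>i j. i \<in> {1..N} \<Longrightarrow> j \<in> {i<..N} \<Longrightarrow>
      (\<integral>\<^sup>+x. ext_potential \<phi> (norm (x i - x j)) - ennreal (K + \<epsilon>) \<partial>P) \<le> ennreal \<epsilon>"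
    using near[OF \<epsilon>] by blast
  interpret P: prob_space P by (rule transport_plansD[OF P])
  have sets_P: "sets P = sets (config_space N)" by (rule transport_plansD[OF P])
  have meas: "(\<lambda>x. ext_potential \<phi> (norm (x i - x j))) \<in> borel_measurable P"
    if "i \<in> {1..N}" "j \<in> {i<..N}" for i j
  proof -
    have ij: "i \<in> {1..N}" "j \<in> {1..N}" using that by auto
    show ?thesis
      unfolding measurable_cong_sets[OF sets_P refl]
      by (intro ext_potential_norm_measurable[OF \<phi>] borel_measurable_diff
          measurable_component_singleton ij)
  qed
  have pair: "(\<integral>\<^sup>+x. ext_potential \<phi> (norm (x i - x j)) \<partial>P) \<le> ennreal (K + 2 * \<epsilon>)"
    if "i \<in> {1..N}" "j \<in> {i<..N}" for i j
  proof -
    note [measurable] = meas[OF that]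
    have "(\<integral>\<^sup>+x. ext_potential \<phi> (norm (x i - x j)) \<partial>P) \<le>
        (\<integral>\<^sup>+x. ennreal (K + \<epsilon>) + (ext_potential \<phi> (norm (x i - x j)) - ennreal (K + \<epsilon>)) \<partial>P)"
      by (intro nn_integral_mono) (auto simp: add_diff_self_ennreal)
    also have "\<dots> = ennreal (K + \<epsilon>) +
        (\<integral>\<^sup>+x. ext_potential \<phi> (norm (x i - x j)) - ennreal (K + \<epsilon>) \<partial>P)"
      by (subst nn_integral_add) (simp_all add: P.emeasure_space_1)
    also have "\<dots> \<le> ennreal (K + \<epsilon>) + ennreal \<epsilon>" by (intro add_left_mono int that)
    also have "\<dots> = ennreal (K + 2 * \<epsilon>)" using K \<epsilon> by (simp flip: ennreal_plus)
    finally show ?thesis .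
  qed
  have "min_cost \<phi> N \<rho> \<le> (\<integral>\<^sup>+x. cost \<phi> N x \<partial>P)"
    unfolding min_cost_def using P by (rule INF_lower)
  also have "\<dots> = (\<Sum>i\<in>{1..N}. \<Sum>j\<in>{i<..N}. \<integral>\<^sup>+x. ext_potential \<phi> (norm (x i - x j)) \<partial>P)"
    unfolding cost_def
    by (subst nn_integral_sum) (auto intro!: borel_measurable_sum meas sum.cong nn_integral_sum)
  also have "\<dots> \<le> (\<Sum>i\<in>{1..N}. \<Sum>j\<in>{i<..N}. ennreal (K + 2 * \<epsilon>))"
    by (intro sum_mono pair)
  also have "\<dots> = ennreal (Q * (K + 2 * \<epsilon>))"
  proof -
    have "(\<Sum>i\<in>{1..N}. real (N - i)) = Q"
      using double_gauss_sum_from_Suc_0[of N, where ?'a = real]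
      by (simp add: Q_def of_nat_diff sum_subtractf field_simps)
    then have Q_c: "(\<Sum>i\<in>{1..N}. \<Sum>j\<in>{i<..N}. c) = Q * c" for c
      by (simp add: sum_distrib_right[symmetric])
    have *: "(\<Sum>i\<in>{1..N}. \<Sum>j\<in>{i<..N}. ennreal c) = ennreal (Q * c)" if "0 \<le> c" for c
      unfolding Q_c[symmetric] using that by (simp add: sum_ennreal sum_nonneg del: sum_constant)
    show ?thesis by (rule *) (use K \<epsilon> in simp)
  qed
  also have "\<dots> \<le> ennreal (Q * K + \<eta>)"
    using \<eta> Q by (intro ennreal_leI) (simp add: \<epsilon>_def field_simps)
  also have "\<dots> = ennreal (Q * K) + ennreal \<eta>" using Q K \<eta> by simp
  finally show "min_cost \<phi> N \<rho> \<le> ennreal (real N * (real N - 1) / 2 * K) + ennreal \<eta>"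
    by (simp add: Q_def)
qed

theorem proposition3p1:
  fixes \<rho> :: "'a::euclidean_space measure"
    and f :: "'a \<Rightarrow> real"
    and \<phi> :: "real \<Rightarrow> real"
    and N :: nat
    and p :: ennreal
    and p' :: real
  assumes "N > 1"
    and "admissible_potential \<phi>"
    and "p > 1"
    and "inverse p + inverse (ennreal p') = 1"
    and "prob_with_Lp_density p \<rho> f"
  shows "(\<forall>P \<alpha>. optimal_plan \<phi> N \<rho> P \<longrightarrow> 0 < \<alpha> \<longrightarrow>
            \<alpha> < the_inv_into {0<..} \<phi>
                  (real N ^ 2 * (real N - 1) / 2 * \<phi> (critical_radius N p p' f)) \<longrightarrow>
            emeasure P (near_diagonal N \<alpha>) = 0) \<and>
         min_cost \<phi> N \<rho> \<le>
           ennreal (real N ^ 3 * (real N - 1)\<^sup>2 / 4 * \<phi> (critical_radius N p p' f))"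
proof -
  note N = assms(1) and \<phi> = assms(2) and p = assms(3,4) and f = assms(5)
  define r where "r = critical_radius N p p' f"
  have r: "0 < r" unfolding r_def by (rule critical_radius_pos[OF N p(1) f])
  have \<phi>r: "0 \<le> \<phi> r" using \<phi> r by (simp add: admissible_potential_def)
  define X where "X = 2 * (real N - 1) * \<phi> r"
  have X: "0 \<le> X" using N \<phi>r by (simp add: X_def)
  \<comment> \<open>\<open>X\<close> is the threshold produced by the exchange and \<open>K0\<close>
    the level in the statement; \<open>X \<le> K0\<close> because \<open>N\<^sup>2\<close> is at
    least 4.\<close>
  define K0 where "K0 = real N ^ 2 * (real N - 1) / 2 * \<phi> r"
  have X_K0: "X \<le> K0"
  proof -
    have "2 ^ 2 \<le> real N ^ 2" using N by (intro power_mono) auto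
    then have "4 * ((real N - 1) / 2 * \<phi> r) \<le> real N ^ 2 * ((real N - 1) / 2 * \<phi> r)"
      using N \<phi>r by (intro mult_right_mono) auto
    moreover have "X = 4 * ((real N - 1) / 2 * \<phi> r)" "K0 = real N ^ 2 * ((real N - 1) / 2 * \<phi> r)"
      by (simp_all add: X_def K0_def)
    ultimately show ?thesis by simp
  qed
  \<comment> \<open>This places \<open>K0\<close> in the range of \<open>\<phi>\<close>, where the
    inverse is meaningful.\<close>
  have \<phi>r_K0: "\<phi> r \<le> K0"
  proof -
    have "1 * \<phi> r \<le> 2 * (real N - 1) * \<phi> r" using N \<phi>r by (intro mult_right_mono) auto
    then show ?thesis using X_K0 by (simp add: X_def)
  qed
  have "\<rho> \<in> space (prob_algebra borel)" using f unfolding prob_with_Lp_density_def by blast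
  then obtain P0 where P0: "P0 \<in> transport_plans N \<rho>" "(\<integral>\<^sup>+x. cost \<phi> N x \<partial>P0) < \<infinity>"
    using exists_finite_cost_plan[OF _ measure_hyperplane_eq_0[OF p f] \<phi>, of N] N by auto
  \<comment> \<open>Finiteness allows \<open>2 * min_cost \<phi> N \<rho>\<close> to be cancelled
    from inequalities in \<open>ennreal\<close>.\<close>
  have fin: "min_cost \<phi> N \<rho> < \<infinity>"
    unfolding min_cost_def using INF_lower[OF P0(1)] P0(2) by (rule le_less_trans)
  have null: "emeasure P (near_diagonal N \<alpha>) = 0"
    if P: "optimal_plan \<phi> N \<rho> P" and \<alpha>: "0 < \<alpha>" "\<alpha> < the_inv_into {0<..} \<phi> K0" for P \<alpha>
  proof -
    have P_plan: "P \<in> transport_plans N \<rho>" and P_opt: "(\<integral>\<^sup>+x. cost \<phi> N x \<partial>P) = min_cost \<phi> N \<rho>"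
      using P by (auto simp: optimal_plan_def)
    have sets_P: "sets P = sets (config_space N)" by (rule transport_plansD[OF P_plan])
    have "\<phi> (the_inv_into {0<..} \<phi> K0) < \<phi> \<alpha>"
      using \<phi> \<alpha> by (auto simp: admissible_potential_def monotone_on_def)
    then have "K0 < \<phi> \<alpha>" using the_inv_into_potential[OF \<phi> r \<phi>r_K0] by simp
    \<comment> \<open>The exchange inequality requires a level strictly above \<open>X\<close>,
      while excluding distances below \<open>\<alpha>\<close> requires one strictly below
      \<open>\<phi> \<alpha>\<close>.\<close>
    then obtain K where K: "K0 < K" "K < \<phi> \<alpha>" using dense by blast
    then have "2 * (real N - 1) * \<phi> (critical_radius N p p' f) < K"
      using X_K0 by (simp add: X_def r_def)
    from min_cost_exchange_critical[OF N \<phi> p f this] obtain \<delta> :: real where \<delta>: "0 < \<delta>"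
      and exch: "\<forall>P\<in>transport_plans N \<rho>. \<forall>i\<in>{1..N}. \<forall>j\<in>{1..N} - {i}.
        2 * min_cost \<phi> N \<rho> +
          ennreal \<delta> * (\<integral>\<^sup>+x. ext_potential \<phi> (norm (x i - x j)) - ennreal K \<partial>P) \<le>
        2 * (\<integral>\<^sup>+x. cost \<phi> N x \<partial>P)"
      by (elim exE conjE) (rule that)
    have pair: "AE x in P. \<alpha> \<le> norm (x i - x j)" if ij: "i \<in> {1..N}" "j \<in> {1..N}" "i \<noteq> j" for i j
    proof -
      let ?e = "\<lambda>x. ext_potential \<phi> (norm (x i - x j))"
      have [measurable]: "?e \<in> borel_measurable P"
        unfolding measurable_cong_sets[OF sets_P refl]
        by (intro ext_potential_norm_measurable[OF \<phi>] borel_measurable_diff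
            measurable_component_singleton ij)
      \<comment> \<open>For an optimal plan both sides contain the same finite minimal cost, so the
        integrated excess must vanish.\<close>
      have "2 * min_cost \<phi> N \<rho> + ennreal \<delta> * (\<integral>\<^sup>+x. ?e x - ennreal K \<partial>P) \<le> 2 * min_cost \<phi> N \<rho> + 0"
        using exch[rule_format, OF P_plan, of i j] ij P_opt by simp
      then have "ennreal \<delta> * (\<integral>\<^sup>+x. ?e x - ennreal K \<partial>P) \<le> 0"
        using fin by (subst (asm) ennreal_add_left_cancel_le) (auto simp: ennreal_mult_eq_top_iff)
      then have "(\<integral>\<^sup>+x. ?e x - ennreal K \<partial>P) = 0" using \<delta> by simp
      then have "AE x in P. ?e x - ennreal K = 0" by (subst (asm) nn_integral_0_iff_AE) auto
      then show ?thesis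
      proof eventually_elim
        case (elim x)
        have "?e x \<le> ennreal K" by (rule ennreal_minus_eq_0[OF elim])
        also have "ennreal K < ennreal (\<phi> \<alpha>)"
          using K X X_K0 by (intro ennreal_lessI) auto
        finally have "?e x < ennreal (\<phi> \<alpha>)" .
        show ?case
        proof (rule ccontr)
          assume "\<not> \<alpha> \<le> norm (x i - x j)"
          then have "ennreal (\<phi> \<alpha>) \<le> ?e x" using \<alpha>(1) by (intro ext_potential_ge \<phi>) auto
          with \<open>?e x < ennreal (\<phi> \<alpha>)\<close> show False by simp
        qed
      qed
    qed
    have "AE x in P. \<forall>i\<in>{1..N}. \<forall>j\<in>{1..N}. i \<noteq> j \<longrightarrow> \<alpha> \<le> norm (x i - x j)"
      using pair by (intro AE_finite_allI AE_impI) auto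
    then have "AE x in P. x \<notin> near_diagonal N \<alpha>"
      by eventually_elim (force simp: near_diagonal_def)
    then show ?thesis
      \<comment> \<open>A set outside \<open>sets P\<close> has measure 0 by default; in
        \<open>sets P\<close> the almost everywhere statement makes it a null set.\<close>
      by (cases "near_diagonal N \<alpha> \<in> sets P")
        (auto simp: emeasure_notin_sets AE_iff_null_sets[symmetric] null_setsD1)
  qed
  have "min_cost \<phi> N \<rho> \<le> ennreal (real N * (real N - 1) / 2 * X)"
  proof (rule min_cost_le_pairs[OF _ _ X \<phi>])
    fix \<epsilon> :: real assume \<epsilon>: "0 < \<epsilon>"
    have "2 * (real N - 1) * \<phi> (critical_radius N p p' f) < X + \<epsilon>"
      using \<epsilon> by (simp add: X_def r_def)
    from min_cost_exchange_critical[OF N \<phi> p f this] obtain \<delta> :: real where \<delta>: "0 < \<delta>"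
      and exch: "\<forall>P\<in>transport_plans N \<rho>. \<forall>i\<in>{1..N}. \<forall>j\<in>{1..N} - {i}.
        2 * min_cost \<phi> N \<rho> +
          ennreal \<delta> * (\<integral>\<^sup>+x. ext_potential \<phi> (norm (x i - x j)) - ennreal (X + \<epsilon>) \<partial>P) \<le>
        2 * (\<integral>\<^sup>+x. cost \<phi> N x \<partial>P)"
      by (elim exE conjE) (rule that)
    \<comment> \<open>With the tolerance \<open>\<epsilon> * \<delta> / 2\<close>, doubling and
      dividing by \<open>\<delta>\<close> in the exchange inequality leaves an excess of at most
      \<open>\<epsilon>\<close>.\<close>
    have "min_cost \<phi> N \<rho> < min_cost \<phi> N \<rho> + ennreal (\<epsilon> * \<delta> / 2)"
      using fin \<epsilon> \<delta> by (cases "min_cost \<phi> N \<rho>") (auto simp: ennreal_less_iff simp flip: ennreal_plus)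
    then obtain P where P: "P \<in> transport_plans N \<rho>"
      and P_cost: "(\<integral>\<^sup>+x. cost \<phi> N x \<partial>P) < min_cost \<phi> N \<rho> + ennreal (\<epsilon> * \<delta> / 2)"
      unfolding min_cost_def by (subst (asm) INF_less_iff) auto
    have "(\<integral>\<^sup>+x. ext_potential \<phi> (norm (x i - x j)) - ennreal (X + \<epsilon>) \<partial>P) \<le> ennreal \<epsilon>"
      if "i \<in> {1..N}" "j \<in> {i<..N}" for i j
    proof -
      let ?I = "\<integral>\<^sup>+x. ext_potential \<phi> (norm (x i - x j)) - ennreal (X + \<epsilon>) \<partial>P"
      have "2 * min_cost \<phi> N \<rho> + ennreal \<delta> * ?I \<le> 2 * (\<integral>\<^sup>+x. cost \<phi> N x \<partial>P)"
        using that by (intro exch[rule_format] P) auto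
      also have "\<dots> \<le> 2 * (min_cost \<phi> N \<rho> + ennreal (\<epsilon> * \<delta> / 2))"
        using P_cost by (intro mult_left_mono less_imp_le) auto
      also have "\<dots> = 2 * min_cost \<phi> N \<rho> + 2 * ennreal (\<epsilon> * \<delta> / 2)" by (simp add: distrib_left)
      also have "2 * ennreal (\<epsilon> * \<delta> / 2) = ennreal \<delta> * ennreal \<epsilon>"
        using \<epsilon> \<delta> by (simp add: ennreal_mult[symmetric] ennreal_numeral[symmetric] mult.commute del: ennreal_numeral)
      finally have "ennreal \<delta> * ?I \<le> ennreal \<delta> * ennreal \<epsilon>"
        using fin by (subst (asm) ennreal_add_left_cancel_le) (auto simp: ennreal_mult_eq_top_iff)
      then show ?thesis using \<delta> by (subst (asm) ennreal_mult_le_mult_iff) auto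
    qed
    with P show "\<exists>P\<in>transport_plans N \<rho>. \<forall>i\<in>{1..N}. \<forall>j\<in>{i<..N}.
        (\<integral>\<^sup>+x. ext_potential \<phi> (norm (x i - x j)) - ennreal (X + \<epsilon>) \<partial>P) \<le> ennreal \<epsilon>"
      by blast
  qed (use N in auto)
  then have "min_cost \<phi> N \<rho> \<le> ennreal (real N ^ 3 * (real N - 1)\<^sup>2 / 4 * \<phi> r)"
  proof (rule order_trans[OF _ ennreal_leI])
    \<comment> \<open>The bound obtained with \<open>X\<close> is weakened to the stated constant,
      which is \<open>N (N - 1) / 2\<close> times \<open>K0\<close>.\<close>
    have "real N * (real N - 1) / 2 * X \<le> real N * (real N - 1) / 2 * K0"
      using N by (intro mult_left_mono X_K0) auto
    then show "real N * (real N - 1) / 2 * X \<le> real N ^ 3 * (real N - 1)\<^sup>2 / 4 * \<phi> r"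
      by (simp add: K0_def power2_eq_square power3_eq_cube ac_simps)
  qed
  with null show ?thesis unfolding K0_def r_def by blast
qed

end
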